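(* Let $T>0$, $\mu\in\mathbb{R}$, $D=(0,1)$. Let $u$ be the mild solution to the linearized Cahn-Hilliard-Cook problem $$u_t+u_{xxxx}+\mu u_{xx}=\partial_x\dot W\ \text{ in }(0,T]\times D,\quad u(t,\cdot)|_{\partial D}=u_{xx}(t,\cdot)|_{\partial D}=0\ \ \forall t\in(0,T],\quad u(0,\cdot)=0,$$ and, for $\mathsf{M},\mathsf{N}\in\mathbb{N}$ and $\Delta t=T/\mathsf{N}$, let $\mathsf{u}$ be the solution to the canvas problem obtained by replacing $\dot W$ by the finite-dimensional load $\mathcal{W}=\mathcal W_{\mathsf N,\mathsf M}$ (all defined in the context). Let $\kappa\in\mathbb{N}$ be such that $\kappa^2\pi^2>\mu$. Then there exists a constant $\widehat c>0$, independent of $\Delta t$ and $\mathsf{M}$, such that $$\max_{t\in[0,T]}\left(\mathbb{E}\left[\|u(t,\cdot)-\mathsf{u}(t,\cdot)\|_{L^2(D)}^2\right]\right)^{1/2}\le \widehat c\,\left(\Delta t^{1/8}+\mathsf{M}^{-1/2}\right)\qquad\forall\,\mathsf{M}\ge\kappa .$$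
   Context: $(\Omega,\mathcal F,P)$ is a complete probability space, $\dot W$ is a space-time white noise on $[0,T]\times D$, and $\int\!\int g\,dW$ denotes the (Walsh/Wiener) stochastic integral with respect to it. For $k\in\mathbb{N}=\{1,2,\dots\}$: $\lambda_k:=k\pi$, $\varepsilon_k(z):=\sqrt2\sin(\lambda_kz)$, $\varphi_k(z):=\sqrt2\cos(\lambda_kz)$. Kernel: $\Psi_t(x,y):=-\sum_{k=1}^\infty\lambda_k e^{-\lambda_k^2(\lambda_k^2-\mu)t}\varepsilon_k(x)\varphi_k(y)$ for $t\in(0,T]$, $x,y\in\overline D$. Mild solution: $u(t,x)=\int_0^t\int_D\Psi_{t-s}(x,y)\,dW(s,y)$. Canvas problem: for $\mathsf{M},\mathsf{N}\in\mathbb{N}$, put $\Delta t:=T/\mathsf{N}$, $t_n:=n\Delta t$, $\mathsf{T}_n:=(t_{n-1},t_n)$ for $n=1,\dots,\mathsf N$, and $$R_i^n:=\int_{\mathsf{T}_n}\int_D\varphi_i(x)\,dW(t,x),\qquad \mathcal{W}(t,x):=\frac1{\Delta t}\sum_{i=1}^{\mathsf{M}}R_i^n\varphi_i(x)\ \text{ for }t\in\mathsf{T}_n,\ x\in D,\ n=1,\dots,\mathsf{N}.$$ The $R_i^n$ are independent $\mathcal{N}(0,\Delta t)$ random variables. The canvas solution $\mathsf{u}$ solves $\mathsf{u}_t+\mathsf{u}_{xxxx}+\mu\mathsf{u}_{xx}=\partial_x\mathcal{W}$ in $(0,T]\times D$, $\mathsf{u}(t,\cdot)|_{\partial D}=\mathsf{u}_{xx}(t,\cdot)|_{\partial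 D}=0$ for $t\in(0,T]$, $\mathsf{u}(0,\cdot)=0$, and is given by $\mathsf{u}(t,x)=\int_0^t\int_D\Psi_{t-s}(x,y)\,\mathcal{W}(s,y)\,dy\,ds$ for $(t,x)\in[0,T]\times\overline D$. *)

theory Defs
  imports "HOL-Probability.Probability"
begin

definition domD :: "real set" where
  "domD = {0<..<1}"

definition centered_normal :: "'w measure \<Rightarrow> ('w \<Rightarrow> real) \<Rightarrow> real \<Rightarrow> bool" where
  "centered_normal P X v \<longleftrightarrow>
     X \<in> borel_measurable P \<and>
     (if v = 0 then (AE \<omega> in P. X \<omega> = 0)
      else distributed P lborel X (\<lambda>x. ennreal (normal_density 0 (sqrt v) x)))"

text \<open>
  White noise on a Borel set \<^term>\<open>S\<close> of finite Lebesgue measure, in the sense of Walsh: a random set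
  function on the Borel subsets of \<^term>\<open>S\<close>, with values normal of variance the Lebesgue measure
  of the set, independent on disjoint sets and almost surely additive.
\<close>

definition white_noise ::
  "'w measure \<Rightarrow> (real \<times> real) set \<Rightarrow> ((real \<times> real) set \<Rightarrow> 'w \<Rightarrow> real) \<Rightarrow> bool" where
  "white_noise P S W \<longleftrightarrow>
     (\<forall>A. A \<in> sets borel \<and> A \<subseteq> S \<longrightarrow> centered_normal P (W A) (measure lborel A)) \<and>
     (\<forall>(I :: nat set) A. finite I \<and> (\<forall>i\<in>I. A i \<in> sets borel \<and> A i \<subseteq> S) \<and> disjoint_family_on A I
        \<longrightarrow> prob_space.indep_vars P (\<lambda>_. borel) (\<lambda>i. W (A i)) I) \<and>
     (\<forall>A B. A \<in> sets borel \<and> B \<in> sets borel \<and> A \<subseteq> S \<and> B \<subseteq> S \<and> A \<inter> B = {}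
        \<longrightarrow> (AE \<omega> in P. W (A \<union> B) \<omega> = W A \<omega> + W B \<omega>))"

definition simple_wiener_integral ::
  "(real \<times> real) set \<Rightarrow> ((real \<times> real) set \<Rightarrow> 'w \<Rightarrow> real) \<Rightarrow> (real \<times> real \<Rightarrow> real) \<Rightarrow> 'w \<Rightarrow> real" where
  "simple_wiener_integral S W h \<omega> = (\<Sum>c\<in>h ` S. c * W {z \<in> S. h z = c} \<omega>)"

text \<open>
  The stochastic integral of a deterministic square integrable integrand \<^term>\<open>g\<close> over \<^term>\<open>S\<close>
  is an almost surely unique random variable; \<open>has_wiener_integral P S W g X\<close> says that
  \<^term>\<open>X\<close> is a version of it: simple functions converge to \<^term>\<open>g\<close> in \<open>L\<^sup>2(S)\<close> while their integrals
  converge to \<^term>\<open>X\<close> in \<open>L\<^sup>2(P)\<close>.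
\<close>

definition has_wiener_integral ::
  "'w measure \<Rightarrow> (real \<times> real) set \<Rightarrow> ((real \<times> real) set \<Rightarrow> 'w \<Rightarrow> real) \<Rightarrow> (real \<times> real \<Rightarrow> real)
     \<Rightarrow> ('w \<Rightarrow> real) \<Rightarrow> bool" where
  "has_wiener_integral P S W g X \<longleftrightarrow>
     g \<in> borel_measurable (restrict_space borel S) \<and> X \<in> borel_measurable P \<and>
     (\<exists>h. (\<forall>j. simple_function (restrict_space borel S) (h j)) \<and>
        (\<lambda>j::nat. \<integral>\<^sup>+z\<in>S. ennreal ((h j z - g z)\<^sup>2) \<partial>lborel) \<longlonglongrightarrow> 0 \<and>
        (\<lambda>j::nat. \<integral>\<^sup>+\<omega>. ennreal ((simple_wiener_integral S W (h j) \<omega> - X \<omega>)\<^sup>2) \<partial>P) \<longlonglongrightarrow> 0)"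

definition lam :: "nat \<Rightarrow> real" where
  "lam k = real k * pi"

definition eps :: "nat \<Rightarrow> real \<Rightarrow> real" where
  "eps k z = sqrt 2 * sin (lam k * z)"

definition phi :: "nat \<Rightarrow> real \<Rightarrow> real" where
  "phi k z = sqrt 2 * cos (lam k * z)"

definition Psi :: "real \<Rightarrow> real \<Rightarrow> real \<Rightarrow> real \<Rightarrow> real" where
  "Psi \<mu> t x y =
     - (\<Sum>j. lam (Suc j) * exp (- ((lam (Suc j))\<^sup>2 * ((lam (Suc j))\<^sup>2 - \<mu>) * t))
            * eps (Suc j) x * phi (Suc j) y)"

text \<open>
  Every \<open>u(t,x)\<close> is only determined up to a null event; as usual a version that is jointly measurable
  in \<open>(\<omega>,x)\<close> is taken, so that the random variable \<open>\<parallel>u(t,\<cdot>)\<parallel>\<close> (norm of \<open>L\<^sup>2(D)\<close>) makes sense.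
  The integral over \<open>(0,t) \<times> D\<close> is the one over \<open>[0,T] \<times> D\<close> with the integrand cut off at \<open>t\<close>.
\<close>

definition mild_solution ::
  "'w measure \<Rightarrow> real \<Rightarrow> real \<Rightarrow> ((real \<times> real) set \<Rightarrow> 'w \<Rightarrow> real) \<Rightarrow> (real \<Rightarrow> real \<Rightarrow> 'w \<Rightarrow> real) \<Rightarrow> bool"
where
  "mild_solution P T \<mu> W u \<longleftrightarrow>
     (\<forall>t\<in>{0..T}. (\<lambda>(\<omega>, x). u t x \<omega>) \<in> borel_measurable (P \<Otimes>\<^sub>M restrict_space borel {0..1})) \<and>
     (\<forall>t\<in>{0..T}. \<forall>x\<in>{0..1}.
        has_wiener_integral P ({0..T} \<times> domD) W
          (\<lambda>(s, y). if s < t then Psi \<mu> (t - s) x y else 0) (u t x))"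

definition time_slab :: "real \<Rightarrow> nat \<Rightarrow> nat \<Rightarrow> real set" where
  "time_slab T N n = {real (n - 1) * (T / real N) <..< real n * (T / real N)}"

text \<open>\<open>R i n\<close> is (a version of) the integral of \<^term>\<open>phi i\<close> over the \<open>n\<close>-th slab times \<open>D\<close>.\<close>

definition canvas_coeffs ::
  "'w measure \<Rightarrow> real \<Rightarrow> ((real \<times> real) set \<Rightarrow> 'w \<Rightarrow> real) \<Rightarrow> nat \<Rightarrow> nat \<Rightarrow> (nat \<Rightarrow> nat \<Rightarrow> 'w \<Rightarrow> real) \<Rightarrow> bool"
where
  "canvas_coeffs P T W N M R \<longleftrightarrow>
     (\<forall>i\<in>{1..M}. \<forall>n\<in>{1..N}.
        has_wiener_integral P ({0..T} \<times> domD) W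
          (\<lambda>(s, y). indicator (time_slab T N n) s * phi i y) (R i n))"

text \<open>The slabs are disjoint; on the null set of grid times, where the load is unspecified, it is 0.\<close>

definition canvas_load ::
  "real \<Rightarrow> nat \<Rightarrow> nat \<Rightarrow> (nat \<Rightarrow> nat \<Rightarrow> 'w \<Rightarrow> real) \<Rightarrow> real \<Rightarrow> real \<Rightarrow> 'w \<Rightarrow> real" where
  "canvas_load T N M R t x \<omega> =
     (\<Sum>n\<in>{1..N}. indicator (time_slab T N n) t *
        (1 / (T / real N) * (\<Sum>i\<in>{1..M}. R i n \<omega> * phi i x)))"

definition canvas_solution ::
  "real \<Rightarrow> real \<Rightarrow> nat \<Rightarrow> nat \<Rightarrow> (nat \<Rightarrow> nat \<Rightarrow> 'w \<Rightarrow> real) \<Rightarrow> real \<Rightarrow> real \<Rightarrow> 'w \<Rightarrow> real" where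
  "canvas_solution T \<mu> N M R t x \<omega> =
     (LINT s:{0<..<t}|lborel. (LINT y:domD|lborel. Psi \<mu> (t - s) x y * canvas_load T N M R s y \<omega>))"

definition ennreal_sqrt :: "ennreal \<Rightarrow> ennreal" where
  "ennreal_sqrt a = (if a = \<infinity> then \<infinity> else ennreal (sqrt (enn2real a)))"

text \<open>\<open>(E[\<parallel>v\<parallel>\<^sup>2])\<^bsup>1/2\<^esup>\<close> with the norm of \<open>L\<^sup>2(D)\<close>, valued in \<open>[0,\<infinity>]\<close>.\<close>

definition rms_L2 :: "'w measure \<Rightarrow> (real \<Rightarrow> 'w \<Rightarrow> real) \<Rightarrow> ennreal" where
  "rms_L2 P v = ennreal_sqrt (\<integral>\<^sup>+\<omega>. (\<integral>\<^sup>+x\<in>domD. ennreal ((v x \<omega>)\<^sup>2) \<partial>lborel) \<partial>P)"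

end

theory Submission
  imports Defs
begin

text \<open>
  The error at \<open>(t, x)\<close> is a Wiener integral, so its second moment is controlled by the \<open>L\<^sup>2\<close> distance of
  the kernel from its averages over the time slabs, truncated to the first \<open>M\<close> cosine modes. By
  orthogonality the modes decouple. Since \<open>\<lambda>\<^sub>k\<^sup>2 (\<lambda>\<^sub>k\<^sup>2 - \<mu>) \<ge> \<lambda>\<^sub>k\<^sup>4 / 2 - \<mu>\<^sup>2 / 2\<close>, the whole mode \<open>k\<close>
  has squared norm \<open>O(k\<^sup>-\<^sup>2)\<close>, uniformly in \<open>k\<close>; as a function of time it has total variation
  \<open>O(k)\<close>, so averaging over slabs of length \<open>\<Delta>t\<close> costs at most \<open>O(k\<^sup>2 \<Delta>t)\<close>. Using the second bound
  for \<open>k \<le> \<Delta>t\<^bsup>-1/4\<^esup>\<close> and the first one beyond, and for \<open>k > M\<close>, gives a squared error of order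
  \<open>\<Delta>t\<^bsup>1/4\<^esup> + 1/M\<close>.
\<close>

subsection \<open>The Wiener integral\<close>

text \<open>The canvas solution is a pathwise double integral, the mild solution a stochastic one.
  They can be subtracted because the load is a finite combination of the \<open>R i n\<close>: the
  canvas solution is then one as well, with coefficients built from slab averages of
  \<open>mode\<close>.

  The Wiener integral is only a relation between an integrand and a version, and the noise is
  additive only almost surely. Linearity therefore has to be derived, and it is derived from
  covariances rather than from common refinements of level sets.

  The cutoff at \<open>t\<close> limits the rate. As a function of time every mode jumps there from
  1 to 0, however smooth it is before, and the derivative on the noise weights it with
  \<open>lam k\<close>. Over all \<open>k\<close> up to \<open>K\<close> the averaging costs
  \<open>K^3\<close> times \<Delta>t, while the modes beyond leave \<open>1 / K\<close>; the two
  balance when \<open>K^4\<close> is the reciprocal of \<Delta>t. This is the origin of the exponent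
  1/4 for the square and of 1/8 after the root.\<close>

lemma (in prob_space) centered_normal_moments:
  assumes X: "centered_normal M X v" and "0 \<le> v"
  shows "integrable M X" "expectation X = 0"
    "integrable M (\<lambda>\<omega>. (X \<omega>)\<^sup>2)" "expectation (\<lambda>\<omega>. (X \<omega>)\<^sup>2) = v"
proof -
  have [measurable]: "X \<in> borel_measurable M"
    using X by (simp add: centered_normal_def)
  have "integrable M X \<and> expectation X = 0 \<and>
    integrable M (\<lambda>\<omega>. (X \<omega>)\<^sup>2) \<and> expectation (\<lambda>\<omega>. (X \<omega>)\<^sup>2) = v"
  proof (cases "v = 0")
    case True
    then have ae: "AE \<omega> in M. X \<omega> = 0" using X by (simp add: centered_normal_def)
    then have ae2: "AE \<omega> in M. (X \<omega>)\<^sup>2 = 0" by simp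
    have "integrable M X = integrable M (\<lambda>_. 0 :: real)"
      "integrable M (\<lambda>\<omega>. (X \<omega>)\<^sup>2) = integrable M (\<lambda>_. 0 :: real)"
      using ae ae2 by (intro integrable_cong_AE; simp)+
    moreover have "expectation X = expectation (\<lambda>_. 0)"
      "expectation (\<lambda>\<omega>. (X \<omega>)\<^sup>2) = expectation (\<lambda>_. 0)"
      using ae ae2 by (intro integral_cong_AE; simp)+
    ultimately show ?thesis using True by simp
  next
    case False
    then have v: "sqrt v > 0" using \<open>0 \<le> v\<close> by simp
    have D: "distributed M lborel X (normal_density 0 (sqrt v))"
      using X False by (simp add: centered_normal_def)
    have 1: "integrable M X"
      by (subst distributed_integrable[OF D, of "\<lambda>x. x", symmetric])
         (use integrable_normal_moment[OF v, where \<mu> = 0 and k = 1] in auto)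
    have 2: "integrable M (\<lambda>\<omega>. (X \<omega>)\<^sup>2)"
      by (subst distributed_integrable[OF D, of "\<lambda>x. x\<^sup>2", symmetric])
         (use integrable_normal_moment[OF v, where \<mu> = 0 and k = 2] in auto)
    have 3: "expectation X = 0" using normal_distributed_expectation[OF v D] by simp
    have "variance X = v" using normal_distributed_variance[OF v D] \<open>0 \<le> v\<close> by simp
    then show ?thesis using 1 2 3 by simp
  qed
  then show "integrable M X" "expectation X = 0"
    "integrable M (\<lambda>\<omega>. (X \<omega>)\<^sup>2)" "expectation (\<lambda>\<omega>. (X \<omega>)\<^sup>2) = v" by auto
qed

lemma integrable_mult_square_integrable:
  fixes f g :: "'a \<Rightarrow> real"
  assumes [measurable]: "f \<in> borel_measurable M" "g \<in> borel_measurable M"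
    and "integrable M (\<lambda>x. (f x)\<^sup>2)" "integrable M (\<lambda>x. (g x)\<^sup>2)"
  shows "integrable M (\<lambda>x. f x * g x)"
proof (rule Bochner_Integration.integrable_bound)
  show "integrable M (\<lambda>x. (f x)\<^sup>2 + (g x)\<^sup>2)" using assms by simp
  have ab: "\<bar>a * b\<bar> \<le> \<bar>a\<^sup>2 + b\<^sup>2\<bar>" for a b :: real
  proof -
    have "2 * \<bar>a\<bar> * \<bar>b\<bar> \<le> a\<^sup>2 + b\<^sup>2"
      using sum_squares_bound[of "\<bar>a\<bar>" "\<bar>b\<bar>"] by simp
    moreover have "0 \<le> \<bar>a\<bar> * \<bar>b\<bar>" by simp
    ultimately show ?thesis unfolding abs_mult by linarith
  qed
  show "AE x in M. norm (f x * g x) \<le> norm ((f x)\<^sup>2 + (g x)\<^sup>2)"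
    by (rule AE_I2) (simp only: real_norm_def ab)
qed measurable

text \<open>Finiteness of the measure of \<open>S\<close> ensures that
  \<open>measure lborel A\<close> is the actual Lebesgue measure of each Borel \<open>A\<close> in
  \<open>S\<close>, not the default value 0 of a set of infinite measure.\<close>

locale finite_white_noise = prob_space M for M :: "'w measure" +
  fixes S :: "(real \<times> real) set" and W
  assumes S_borel [measurable]: "S \<in> sets borel"
    and S_finite: "emeasure lborel S < \<infinity>"
    and noise: "white_noise M S W"
begin

lemma emeasure_finite: "A \<subseteq> S \<Longrightarrow> emeasure lborel A < \<infinity>"
  using emeasure_mono[of A S lborel] S_finite S_borel by (auto intro: le_less_trans)

lemma
  assumes "A \<in> sets borel" "A \<subseteq> S"
  shows W_measurable: "W A \<in> borel_measurable M"
    and W_integrable: "integrable M (W A)"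
    and W_mean: "expectation (W A) = 0"
    and W_square_integrable: "integrable M (\<lambda>\<omega>. (W A \<omega>)\<^sup>2)"
    and W_variance: "expectation (\<lambda>\<omega>. (W A \<omega>)\<^sup>2) = measure lborel A"
proof -
  have "centered_normal M (W A) (measure lborel A)" using noise assms by (simp add: white_noise_def)
  from centered_normal_moments[OF this] this
  show "W A \<in> borel_measurable M" "integrable M (W A)" "expectation (W A) = 0"
     "integrable M (\<lambda>\<omega>. (W A \<omega>)\<^sup>2)" "expectation (\<lambda>\<omega>. (W A \<omega>)\<^sup>2) = measure lborel A"
    by (auto simp: centered_normal_def)
qed

lemma W_product_integrable:
  assumes "A \<in> sets borel" "A \<subseteq> S" "B \<in> sets borel" "B \<subseteq> S"
  shows "integrable M (\<lambda>\<omega>. W A \<omega> * W B \<omega>)"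
  using assms
  by (intro integrable_mult_square_integrable W_measurable W_square_integrable)

lemma W_disjoint:
  assumes "A \<in> sets borel" "A \<subseteq> S" "B \<in> sets borel" "B \<subseteq> S" "A \<inter> B = {}"
  shows "expectation (\<lambda>\<omega>. W A \<omega> * W B \<omega>) = 0"
proof -
  \<comment> \<open>Independence is stated for families indexed by naturals, so the pair is coded by
    the indices 0 and 1.\<close>
  define C where "C = (\<lambda>i::nat. if i = 0 then A else B)"
  have "disjoint_family_on C {0, 1}"
    using assms by (auto simp: disjoint_family_on_def C_def)
  moreover have "\<forall>i\<in>{0, 1}. C i \<in> sets borel \<and> C i \<subseteq> S" using assms by (simp add: C_def)
  ultimately have "indep_vars (\<lambda>_. borel) (\<lambda>i. W (C i)) {0, 1}"
    using noise unfolding white_noise_def by (meson finite.emptyI finite.insertI)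
  from indep_vars_lebesgue_integral[OF _ this] assms show ?thesis
    by (simp add: C_def W_integrable W_mean)
qed

text \<open>Both sets are split into their common part and a difference. The cross terms belong to
  disjoint sets, are independent and centered, and vanish; the variance of the common part
  remains.\<close>

lemma W_covariance:
  assumes A: "A \<in> sets borel" "A \<subseteq> S" and B: "B \<in> sets borel" "B \<subseteq> S"
  shows "expectation (\<lambda>\<omega>. W A \<omega> * W B \<omega>) = measure lborel (A \<inter> B)"
proof -
  have add: "AE \<omega> in M. W X \<omega> = W (X \<inter> Y) \<omega> + W (X - Y) \<omega>"
    if "X \<in> sets borel" "X \<subseteq> S" "Y \<in> sets borel" for X Y
  proof -
    have "X \<inter> Y \<in> sets borel" "X - Y \<in> sets borel" "X \<inter> Y \<subseteq> S" "X - Y \<subseteq> S"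
      "(X \<inter> Y) \<inter> (X - Y) = {}" using that by auto
    then have "AE \<omega> in M. W (X \<inter> Y \<union> (X - Y)) \<omega> = W (X \<inter> Y) \<omega> + W (X - Y) \<omega>"
      using noise unfolding white_noise_def by blast
    then show ?thesis by (simp add: Int_Diff_Un)
  qed
  define C D E where "C = A \<inter> B" and "D = A - B" and "E = B - A"
  have m: "C \<in> sets borel" "D \<in> sets borel" "E \<in> sets borel" "C \<subseteq> S" "D \<subseteq> S" "E \<subseteq> S"
    using A B by (auto simp: C_def D_def E_def)
  have dj: "C \<inter> E = {}" "D \<inter> C = {}" "D \<inter> E = {}" by (auto simp: C_def D_def E_def)
  note [measurable] = W_measurable[OF A] W_measurable[OF B] W_measurable[OF m(1,4)]
     W_measurable[OF m(2,5)] W_measurable[OF m(3,6)]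
  note [simp] = W_product_integrable[OF m(1,4) m(1,4)] W_product_integrable[OF m(1,4) m(3,6)]
    W_product_integrable[OF m(2,5) m(1,4)] W_product_integrable[OF m(2,5) m(3,6)]
  have "AE \<omega> in M. W A \<omega> * W B \<omega> =
      W C \<omega> * W C \<omega> + W C \<omega> * W E \<omega> + (W D \<omega> * W C \<omega> + W D \<omega> * W E \<omega>)"
    using add[OF A B(1)] add[OF B A(1)]
    by eventually_elim (simp add: C_def D_def E_def Int_commute algebra_simps)
  then have "expectation (\<lambda>\<omega>. W A \<omega> * W B \<omega>) = expectation (\<lambda>\<omega>.
      W C \<omega> * W C \<omega> + W C \<omega> * W E \<omega> + (W D \<omega> * W C \<omega> + W D \<omega> * W E \<omega>))"
    by (intro integral_cong_AE) auto
  also have "\<dots> = measure lborel C"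
    using W_variance[OF m(1,4)] W_disjoint[OF m(1,4) m(3,6) dj(1)]
      W_disjoint[OF m(2,5) m(1,4) dj(2)] W_disjoint[OF m(2,5) m(3,6) dj(3)]
    by (simp add: power2_eq_square)
  finally show ?thesis by (simp add: C_def)
qed

abbreviation simple :: "(real \<times> real \<Rightarrow> real) \<Rightarrow> bool" where
  "simple \<equiv> simple_function (restrict_space borel S)"

abbreviation I :: "(real \<times> real \<Rightarrow> real) \<Rightarrow> 'w \<Rightarrow> real" where
  "I \<equiv> simple_wiener_integral S W"

lemma simple_levels:
  assumes "simple h"
  shows "finite (h ` S)" "{z \<in> S. h z = c} \<in> sets borel" "{z \<in> S. h z = c} \<subseteq> S"
proof -
  show "finite (h ` S)" using simple_functionD(1)[OF assms] by (simp add: space_restrict_space)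
  have "h -` {c} \<inter> S \<in> sets (restrict_space borel S)"
    using simple_functionD(2)[OF assms, of "{c}"] by (simp add: space_restrict_space)
  then have "h -` {c} \<inter> S \<in> sets borel"
    by (subst (asm) sets_restrict_space_iff) auto
  also have "h -` {c} \<inter> S = {z \<in> S. h z = c}" by auto
  finally show "{z \<in> S. h z = c} \<in> sets borel" .
qed auto

lemma I_measurable: "simple h \<Longrightarrow> I h \<in> borel_measurable M"
  unfolding simple_wiener_integral_def
  by (intro borel_measurable_sum borel_measurable_times borel_measurable_const W_measurable
    simple_levels)

text \<open>Both sides are sums over pairs of level sets, on which \<open>W_covariance\<close>
  applies. The form with two different integrands, rather than the isometry alone, is what the proof
  of linearity consumes.\<close>

lemma I_covariance:
  assumes h: "simple h" and k: "simple k"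
  shows "integrable M (\<lambda>\<omega>. I h \<omega> * I k \<omega>)"
    and "set_integrable lborel S (\<lambda>z. h z * k z)"
    and "expectation (\<lambda>\<omega>. I h \<omega> * I k \<omega>) = (LINT z:S|lborel. h z * k z)"
proof -
  note l = simple_levels[OF h] simple_levels[OF k]
  let ?A = "\<lambda>c. {z \<in> S. h z = c}" and ?B = "\<lambda>c. {z \<in> S. k z = c}"
  have prod: "I h \<omega> * I k \<omega> = (\<Sum>c\<in>h ` S. \<Sum>d\<in>k ` S. (c * d) * (W (?A c) \<omega> * W (?B d) \<omega>))" for \<omega>
    by (simp add: simple_wiener_integral_def sum_product mult_ac)
  have int: "integrable M (\<lambda>\<omega>. (c * d) * (W (?A c) \<omega> * W (?B d) \<omega>))" for c d
    by (intro integrable_mult_right W_product_integrable l)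
  show "integrable M (\<lambda>\<omega>. I h \<omega> * I k \<omega>)"
    unfolding prod by (intro Bochner_Integration.integrable_sum int)
  have ind: "indicator S z * (h z * k z) =
      (\<Sum>c\<in>h ` S. \<Sum>d\<in>k ` S. (c * d) * indicator (?A c \<inter> ?B d) z)" for z
  proof (cases "z \<in> S")
    case True
    have "(\<Sum>c\<in>h ` S. \<Sum>d\<in>k ` S. (c * d) * indicator (?A c \<inter> ?B d) z :: real) =
        (\<Sum>c\<in>h ` S. \<Sum>d\<in>k ` S. (if c = h z then if d = k z then c * d else 0 else 0))"
      by (intro sum.cong) (auto simp: indicator_def True)
    also have "\<dots> = (\<Sum>c\<in>h ` S. if c = h z then \<Sum>d\<in>k ` S. if d = k z then c * d else 0 else 0)"
      by (intro sum.cong) auto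
    also have "\<dots> = h z * k z" using True l(1,4) by (simp add: sum.delta)
    finally show ?thesis using True by simp
  qed simp
  have fin: "integrable lborel (\<lambda>z. (c * d) * indicator (?A c \<inter> ?B d) z :: real)" for c d
    using l(2,5)[of c] l(2,5)[of d] emeasure_finite[of "?A c \<inter> ?B d"]
    by (intro integrable_mult_right integrable_real_indicator) auto
  show "set_integrable lborel S (\<lambda>z. h z * k z)"
    unfolding set_integrable_def real_scaleR_def ind
    by (intro Bochner_Integration.integrable_sum fin)
  have "expectation (\<lambda>\<omega>. I h \<omega> * I k \<omega>) =
      (\<Sum>c\<in>h ` S. \<Sum>d\<in>k ` S. (c * d) * measure lborel (?A c \<inter> ?B d))"
    unfolding prod
    by (subst Bochner_Integration.integral_sum, intro Bochner_Integration.integrable_sum int,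
        subst Bochner_Integration.integral_sum, intro int)
       (simp add: W_covariance l)
  also have "\<dots> = (LINT z|lborel. indicator S z * (h z * k z))"
    unfolding ind
    by (subst Bochner_Integration.integral_sum, intro Bochner_Integration.integrable_sum fin,
        subst Bochner_Integration.integral_sum, intro fin) simp
  finally show "expectation (\<lambda>\<omega>. I h \<omega> * I k \<omega>) = (LINT z:S|lborel. h z * k z)"
    by (simp add: set_lebesgue_integral_def)
qed

end

section \<open>Mean-square limits and linearity of the Wiener integral\<close>

lemma nn_integral_square_lincomb_le:
  fixes f g :: "'a \<Rightarrow> real"
  assumes [measurable]: "f \<in> borel_measurable M" "g \<in> borel_measurable M"
  shows "(\<integral>\<^sup>+x. ennreal ((a * f x + g x)\<^sup>2) \<partial>M) \<le>
    ennreal (2 * a\<^sup>2) * (\<integral>\<^sup>+x. ennreal ((f x)\<^sup>2) \<partial>M) + 2 * (\<integral>\<^sup>+x. ennreal ((g x)\<^sup>2) \<partial>M)"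
proof -
  have "ennreal ((a * f x + g x)\<^sup>2) \<le>
      ennreal (2 * a\<^sup>2) * ennreal ((f x)\<^sup>2) + 2 * ennreal ((g x)\<^sup>2)" for x
  proof -
    have "(a * f x + g x)\<^sup>2 \<le> (2 * a\<^sup>2) * (f x)\<^sup>2 + 2 * (g x)\<^sup>2"
      using zero_le_power2[of "a * f x - g x"] by (simp add: power2_eq_square algebra_simps)
    then have "ennreal ((a * f x + g x)\<^sup>2) \<le> ennreal ((2 * a\<^sup>2) * (f x)\<^sup>2 + 2 * (g x)\<^sup>2)"
      by (rule ennreal_leI)
    then show ?thesis by (simp add: ennreal_plus ennreal_mult)
  qed
  then have "(\<integral>\<^sup>+x. ennreal ((a * f x + g x)\<^sup>2) \<partial>M) \<le>
      (\<integral>\<^sup>+x. ennreal (2 * a\<^sup>2) * ennreal ((f x)\<^sup>2) + 2 * ennreal ((g x)\<^sup>2) \<partial>M)"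
    by (rule nn_integral_mono)
  also have "\<dots> = ennreal (2 * a\<^sup>2) * (\<integral>\<^sup>+x. ennreal ((f x)\<^sup>2) \<partial>M) + 2 * (\<integral>\<^sup>+x. ennreal ((g x)\<^sup>2) \<partial>M)"
    by (simp add: nn_integral_add nn_integral_cmult)
  finally show ?thesis .
qed

text \<open>A stand-in for Minkowski's inequality, resting on \<open>(a * v + w)^2\<close> being at
  most \<open>2 * a^2 * v^2 + 2 * w^2\<close>. With extended integrals no integrability has to be
  tracked. It serves twice: on \<open>S\<close> for the integrands and on the probability space for
  their integrals.\<close>

lemma nn_integral_square_lincomb_tendsto_0:
  fixes f g :: "nat \<Rightarrow> 'a \<Rightarrow> real"
  assumes "\<And>j. f j \<in> borel_measurable M" "\<And>j. g j \<in> borel_measurable M"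
    and f: "(\<lambda>j. \<integral>\<^sup>+x. ennreal ((f j x)\<^sup>2) \<partial>M) \<longlonglongrightarrow> 0"
    and g: "(\<lambda>j. \<integral>\<^sup>+x. ennreal ((g j x)\<^sup>2) \<partial>M) \<longlonglongrightarrow> 0"
  shows "(\<lambda>j. \<integral>\<^sup>+x. ennreal ((a * f j x + g j x)\<^sup>2) \<partial>M) \<longlonglongrightarrow> 0"
proof (rule tendsto_sandwich[OF _ _ tendsto_const])
  have "(\<lambda>j. ennreal (2 * a\<^sup>2) * (\<integral>\<^sup>+x. ennreal ((f j x)\<^sup>2) \<partial>M) + 2 * (\<integral>\<^sup>+x. ennreal ((g j x)\<^sup>2) \<partial>M))
      \<longlonglongrightarrow> ennreal (2 * a\<^sup>2) * 0 + 2 * 0"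
    by (intro tendsto_add ennreal_tendsto_cmult f g) auto
  then show "(\<lambda>j. ennreal (2 * a\<^sup>2) * (\<integral>\<^sup>+x. ennreal ((f j x)\<^sup>2) \<partial>M) + 2 * (\<integral>\<^sup>+x. ennreal ((g j x)\<^sup>2) \<partial>M))
      \<longlonglongrightarrow> 0" by simp
  show "\<forall>\<^sub>F j in sequentially. (\<integral>\<^sup>+x. ennreal ((a * f j x + g j x)\<^sup>2) \<partial>M) \<le>
     ennreal (2 * a\<^sup>2) * (\<integral>\<^sup>+x. ennreal ((f j x)\<^sup>2) \<partial>M) + 2 * (\<integral>\<^sup>+x. ennreal ((g j x)\<^sup>2) \<partial>M)"
    using assms by (intro always_eventually allI nn_integral_square_lincomb_le) auto
qed auto

context finite_white_noise
begin

lemma I_isometry: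
  assumes "simple h"
  shows "(\<integral>\<^sup>+\<omega>. ennreal ((I h \<omega>)\<^sup>2) \<partial>M) = (\<integral>\<^sup>+z\<in>S. ennreal ((h z)\<^sup>2) \<partial>lborel)"
proof -
  have "(\<integral>\<^sup>+\<omega>. ennreal ((I h \<omega>)\<^sup>2) \<partial>M) = ennreal (LINT z:S|lborel. h z * h z)"
    using I_covariance[OF assms assms]
    by (subst nn_integral_eq_integral) (auto simp: power2_eq_square)
  also have "\<dots> = (\<integral>\<^sup>+z. ennreal (indicator S z * (h z * h z)) \<partial>lborel)"
    using I_covariance(2)[OF assms assms]
    by (subst nn_integral_eq_integral) (auto simp: set_integrable_def set_lebesgue_integral_def)
  also have "\<dots> = (\<integral>\<^sup>+z\<in>S. ennreal ((h z)\<^sup>2) \<partial>lborel)"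
    by (intro nn_integral_cong) (auto simp: indicator_def power2_eq_square)
  finally show ?thesis .
qed

text \<open>The level sets of \<open>a * h + k\<close> are unrelated to those of \<open>h\<close>
  and \<open>k\<close>. Instead of refining them, the second moment of the difference of both sides
  is computed: covariances agree with inner products on \<open>S\<close>, so it equals the integral
  of the square of a function that is identically 0.\<close>

lemma I_lincomb:
  assumes h: "simple h" and k: "simple k"
  shows "AE \<omega> in M. I (\<lambda>z. a * h z + k z) \<omega> = a * I h \<omega> + I k \<omega>"
proof -
  define u where "u = (\<lambda>z. a * h z + k z)"
  have u: "simple u" unfolding u_def using h k by (intro simple_function_compose2[of _ _ _ "\<lambda>x y. a * x + y"]) auto
  \<comment> \<open>\<open>F\<close> is the square of \<open>x - (a * y + z)\<close>, written out as
    a linear combination of products so that \<open>I_covariance\<close> applies to each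
    term.\<close>
  define F where "F = (\<lambda>(x::real) y z. x * x + a\<^sup>2 * (y * y) + z * z + (- (2 * a)) * (x * y) + (- 2) * (x * z) + 2 * a * (y * z))"
  have F: "(x - (a * y + z))\<^sup>2 = F x y z" for x y z
    by (simp add: F_def power2_eq_square algebra_simps)
  note cov = I_covariance[OF u u] I_covariance[OF h h] I_covariance[OF k k] I_covariance[OF u h]
    I_covariance[OF u k] I_covariance[OF h k]
  have int: "integrable M (\<lambda>\<omega>. F (I u \<omega>) (I h \<omega>) (I k \<omega>))"
    unfolding F_def using cov by simp
  have "expectation (\<lambda>\<omega>. F (I u \<omega>) (I h \<omega>) (I k \<omega>)) = (LINT z:S|lborel. F (u z) (h z) (k z))"
    unfolding F_def using cov
    by (simp add: set_integral_add)
  also have "\<dots> = (LINT z:S|lborel. 0)" by (simp add: F[symmetric] u_def)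
  finally have "expectation (\<lambda>\<omega>. F (I u \<omega>) (I h \<omega>) (I k \<omega>)) = 0" by (simp add: set_lebesgue_integral_def)
  then have "AE \<omega> in M. F (I u \<omega>) (I h \<omega>) (I k \<omega>) = 0"
    using int by (subst (asm) integral_nonneg_eq_0_iff_AE) (simp_all add: F[symmetric])
  then show ?thesis by (simp add: F[symmetric] u_def)
qed

lemma nn_integral_S: "(\<integral>\<^sup>+z\<in>S. f z \<partial>lborel) = (\<integral>\<^sup>+z. f z \<partial>restrict_space lborel S)"
  by (subst nn_integral_restrict_space) simp_all

lemma borel_measurable_S:
  "borel_measurable (restrict_space lborel S) = borel_measurable (restrict_space borel S)"
  by (intro measurable_cong_sets sets_restrict_space_cong) auto

lemma simple_measurable: "simple h \<Longrightarrow> h \<in> borel_measurable (restrict_space borel S)"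
  by (rule borel_measurable_simple_function)

text \<open>The approximating simple functions are combined index by index; since only integrals
  over the probability space are compared, almost sure linearity of \<open>I\<close> is
  enough.\<close>

lemma wiener_lincomb:
  assumes "has_wiener_integral M S W g X" and "has_wiener_integral M S W g' X'"
  shows "has_wiener_integral M S W (\<lambda>z. a * g z + g' z) (\<lambda>\<omega>. a * X \<omega> + X' \<omega>)"
proof -
  obtain h where h: "\<And>j. simple (h j)"
    "(\<lambda>j::nat. \<integral>\<^sup>+z. ennreal ((h j z - g z)\<^sup>2) \<partial>restrict_space lborel S) \<longlonglongrightarrow> 0"
    "(\<lambda>j::nat. \<integral>\<^sup>+\<omega>. ennreal ((I (h j) \<omega> - X \<omega>)\<^sup>2) \<partial>M) \<longlonglongrightarrow> 0"
    using assms(1) unfolding has_wiener_integral_def nn_integral_S by auto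
  obtain k where k: "\<And>j. simple (k j)"
    "(\<lambda>j::nat. \<integral>\<^sup>+z. ennreal ((k j z - g' z)\<^sup>2) \<partial>restrict_space lborel S) \<longlonglongrightarrow> 0"
    "(\<lambda>j::nat. \<integral>\<^sup>+\<omega>. ennreal ((I (k j) \<omega> - X' \<omega>)\<^sup>2) \<partial>M) \<longlonglongrightarrow> 0"
    using assms(2) unfolding has_wiener_integral_def nn_integral_S by auto
  have m: "g \<in> borel_measurable (restrict_space borel S)" "g' \<in> borel_measurable (restrict_space borel S)"
    "X \<in> borel_measurable M" "X' \<in> borel_measurable M"
    using assms unfolding has_wiener_integral_def by auto
  have 1: "(\<lambda>j::nat. \<integral>\<^sup>+z. ennreal ((a * h j z + k j z - (a * g z + g' z))\<^sup>2) \<partial>restrict_space lborel S) \<longlonglongrightarrow> 0"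
    using nn_integral_square_lincomb_tendsto_0[OF _ _ h(2) k(2), of a] m simple_measurable[OF h(1)]
      simple_measurable[OF k(1)]
    by (simp add: borel_measurable_S algebra_simps)
  have "(\<integral>\<^sup>+\<omega>. ennreal ((I (\<lambda>z. a * h j z + k j z) \<omega> - (a * X \<omega> + X' \<omega>))\<^sup>2) \<partial>M) =
      (\<integral>\<^sup>+\<omega>. ennreal ((a * (I (h j) \<omega> - X \<omega>) + (I (k j) \<omega> - X' \<omega>))\<^sup>2) \<partial>M)" for j
    by (intro nn_integral_cong_AE, use I_lincomb[OF h(1)[of j] k(1)[of j], of a] in eventually_elim)
       (simp add: algebra_simps)
  moreover have "(\<lambda>j. \<integral>\<^sup>+\<omega>. ennreal ((a * (I (h j) \<omega> - X \<omega>) + (I (k j) \<omega> - X' \<omega>))\<^sup>2) \<partial>M) \<longlonglongrightarrow> 0"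
    using m I_measurable[OF h(1)] I_measurable[OF k(1)]
    by (intro nn_integral_square_lincomb_tendsto_0 h k) auto
  ultimately have 2: "(\<lambda>j. \<integral>\<^sup>+\<omega>. ennreal ((I (\<lambda>z. a * h j z + k j z) \<omega> - (a * X \<omega> + X' \<omega>))\<^sup>2) \<partial>M) \<longlonglongrightarrow> 0"
    by simp
  have "simple (\<lambda>z. a * h j z + k j z)" for j
    using h(1) k(1) by (intro simple_function_compose2[of _ _ _ "\<lambda>x y. a * x + y"]) auto
  then show ?thesis unfolding has_wiener_integral_def nn_integral_S
    using 1 2 m by (intro conjI exI[of _ "\<lambda>j z. a * h j z + k j z"] allI borel_measurable_add
      borel_measurable_times borel_measurable_const) auto
qed

text \<open>Shaped for the error: \<open>g\<close> will be the kernel of the mild solution, and the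
  sum the expansion of the canvas solution in the coefficients \<open>R i n\<close>.\<close>

lemma wiener_sub_sum:
  assumes "has_wiener_integral M S W g X" "finite J" "\<And>j. j \<in> J \<Longrightarrow> has_wiener_integral M S W (G j) (Y j)"
  shows "has_wiener_integral M S W (\<lambda>z. g z - (\<Sum>j\<in>J. a j * G j z))
    (\<lambda>\<omega>. X \<omega> - (\<Sum>j\<in>J. a j * Y j \<omega>))"
  using assms(2,3)
proof (induction J rule: finite_induct)
  case (insert j J)
  have "has_wiener_integral M S W (\<lambda>z. - a j * G j z + (g z - (\<Sum>j\<in>J. a j * G j z)))
      (\<lambda>\<omega>. - a j * Y j \<omega> + (X \<omega> - (\<Sum>j\<in>J. a j * Y j \<omega>)))"
    using insert by (intro wiener_lincomb) auto
  then show ?case using insert by (simp add: algebra_simps)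
qed (use assms in simp)

text \<open>The optimal constant is 1; for a convergence rate the crude 4 suffices.\<close>

lemma wiener_second_moment_le:
  assumes "has_wiener_integral M S W g X"
  shows "(\<integral>\<^sup>+\<omega>. ennreal ((X \<omega>)\<^sup>2) \<partial>M) \<le> 4 * (\<integral>\<^sup>+z\<in>S. ennreal ((g z)\<^sup>2) \<partial>lborel)"
proof -
  let ?N = "restrict_space lborel S"
  obtain h where h: "\<And>j. simple (h j)"
    "(\<lambda>j::nat. \<integral>\<^sup>+z. ennreal ((h j z - g z)\<^sup>2) \<partial>?N) \<longlonglongrightarrow> 0"
    "(\<lambda>j::nat. \<integral>\<^sup>+\<omega>. ennreal ((I (h j) \<omega> - X \<omega>)\<^sup>2) \<partial>M) \<longlonglongrightarrow> 0"
    using assms(1) unfolding has_wiener_integral_def nn_integral_S by auto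
  have [measurable]: "g \<in> borel_measurable ?N" "X \<in> borel_measurable M" "h j \<in> borel_measurable ?N"
      "I (h j) \<in> borel_measurable M" for j
    using assms simple_measurable[OF h(1)] I_measurable[OF h(1)]
    by (auto simp: has_wiener_integral_def borel_measurable_S)
  let ?G = "\<integral>\<^sup>+z. ennreal ((g z)\<^sup>2) \<partial>?N"
  let ?d = "\<lambda>j. \<integral>\<^sup>+z. ennreal ((h j z - g z)\<^sup>2) \<partial>?N"
  let ?e = "\<lambda>j. \<integral>\<^sup>+\<omega>. ennreal ((I (h j) \<omega> - X \<omega>)\<^sup>2) \<partial>M"
  have "(\<integral>\<^sup>+\<omega>. ennreal ((X \<omega>)\<^sup>2) \<partial>M) \<le> 2 * ?e j + 2 * (2 * ?d j + 2 * ?G)" for j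
  proof -
    have "(\<integral>\<^sup>+\<omega>. ennreal ((X \<omega>)\<^sup>2) \<partial>M) =
        (\<integral>\<^sup>+\<omega>. ennreal ((- 1 * (I (h j) \<omega> - X \<omega>) + I (h j) \<omega>)\<^sup>2) \<partial>M)" by simp
    also have "\<dots> \<le> 2 * ?e j + 2 * (\<integral>\<^sup>+\<omega>. ennreal ((I (h j) \<omega>)\<^sup>2) \<partial>M)"
      using nn_integral_square_lincomb_le[of "\<lambda>\<omega>. I (h j) \<omega> - X \<omega>" M "I (h j)" "- 1"] by simp
    also have "(\<integral>\<^sup>+\<omega>. ennreal ((I (h j) \<omega>)\<^sup>2) \<partial>M) = (\<integral>\<^sup>+z. ennreal ((1 * (h j z - g z) + g z)\<^sup>2) \<partial>?N)"
      using I_isometry[OF h(1)] by (simp add: nn_integral_S)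
    also have "\<dots> \<le> 2 * ?d j + 2 * ?G"
      using nn_integral_square_lincomb_le[of "\<lambda>z. h j z - g z" ?N g 1] by simp
    finally show ?thesis by (simp add: add_left_mono mult_left_mono)
  qed
  moreover have "(\<lambda>j. 2 * ?e j + 2 * (2 * ?d j + 2 * ?G)) \<longlonglongrightarrow> 2 * 0 + 2 * (2 * 0 + 2 * ?G)"
    by (intro tendsto_add ennreal_tendsto_cmult tendsto_const h) auto
  ultimately have "(\<integral>\<^sup>+\<omega>. ennreal ((X \<omega>)\<^sup>2) \<partial>M) \<le> 2 * 0 + 2 * (2 * 0 + 2 * ?G)"
    by (intro LIMSEQ_le_const) auto
  then show ?thesis by (simp add: nn_integral_S mult.assoc[symmetric])
qed

end

subsection \<open>The kernel in cosine modes\<close>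

lemma domD_borel [measurable]: "domD \<in> sets borel"
  by (simp add: domD_def)

lemma emeasure_domD: "emeasure lborel domD = 1"
  by (simp add: domD_def)

lemma continuous_set_integrable_domD:
  fixes f :: "real \<Rightarrow> real"
  assumes "continuous_on UNIV f"
  shows "set_integrable lborel domD f"
proof -
  have "set_integrable lborel {0..1} f"
    using assms by (intro borel_integrable_atLeastAtMost') (auto intro: continuous_on_subset)
  then show ?thesis
    by (rule set_integrable_subset) (auto simp: domD_def)
qed

lemma set_integrable_finite_sum:
  fixes f :: "'i \<Rightarrow> 'a \<Rightarrow> real"
  assumes "\<And>i. i \<in> J \<Longrightarrow> set_integrable M A (f i)"
  shows "set_integrable M A (\<lambda>x. \<Sum>i\<in>J. f i x)"
  using assms unfolding set_integrable_def scaleR_sum_right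
  by (intro Bochner_Integration.integrable_sum) auto

lemma set_integral_finite_sum:
  fixes f :: "'i \<Rightarrow> 'a \<Rightarrow> real"
  assumes "\<And>i. i \<in> J \<Longrightarrow> set_integrable M A (f i)"
  shows "(LINT x:A|M. \<Sum>i\<in>J. f i x) = (\<Sum>i\<in>J. LINT x:A|M. f i x)"
  using assms unfolding set_integrable_def set_lebesgue_integral_def scaleR_sum_right
  by (intro Bochner_Integration.integral_sum) auto

lemma continuous_phi [continuous_intros]: "continuous_on A (phi k)"
  unfolding phi_def by (intro continuous_intros)

lemma continuous_eps [continuous_intros]: "continuous_on A (eps k)"
  unfolding eps_def by (intro continuous_intros)

lemma phi_measurable [measurable]: "phi k \<in> borel_measurable borel"
  by (rule borel_measurable_continuous_onI[OF continuous_phi])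

lemma eps_measurable [measurable]: "eps k \<in> borel_measurable borel"
  by (rule borel_measurable_continuous_onI[OF continuous_eps])

lemma phi_square_le: "(phi k y)\<^sup>2 \<le> 2"
  by (simp add: phi_def power_mult_distrib abs_square_le_1)

lemma eps_square_le: "(eps k x)\<^sup>2 \<le> 2"
  by (simp add: eps_def power_mult_distrib abs_square_le_1)

lemma abs_phi_le: "\<bar>phi k y\<bar> \<le> 2"
proof (rule power2_le_imp_le)
  show "\<bar>phi k y\<bar>\<^sup>2 \<le> 2\<^sup>2" using phi_square_le[of k y] by simp
qed simp

lemma abs_eps_le: "\<bar>eps k x\<bar> \<le> 2"
proof (rule power2_le_imp_le)
  show "\<bar>eps k x\<bar>\<^sup>2 \<le> 2\<^sup>2" using eps_square_le[of k x] by simp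
qed simp

text \<open>The frequency is an integer rather than a natural number because product-to-sum formulas
  produce differences of either sign.\<close>

lemma LINT_domD_cos:
  fixes k :: int
  assumes "k \<noteq> 0"
  shows "(LINT y:domD|lborel. cos (of_int k * pi * y)) = 0"
proof -
  have "((\<lambda>y. cos (of_int k * pi * y)) has_integral
      sin (of_int k * pi * 1) / (of_int k * pi) - sin (of_int k * pi * 0) / (of_int k * pi)) {0..1}"
    using assms
    by (intro fundamental_theorem_of_calculus)
       (auto intro!: derivative_eq_intros simp: has_real_derivative_iff_has_vector_derivative[symmetric])
  then have "integral {0..1} (\<lambda>y. cos (of_int k * pi * y)) = 0"
    using sin_zero_iff_int2[of "of_int k * pi"] by (simp add: integral_unique)
  then have "integral {0<..<1} (\<lambda>y. cos (of_int k * pi * y)) = 0"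
    by (simp add: integral_open_interval_real)
  moreover have "set_integrable lborel domD (\<lambda>y. cos (of_int k * pi * y))"
    by (intro continuous_set_integrable_domD continuous_intros)
  ultimately show ?thesis
    by (subst set_borel_integral_eq_integral) (auto simp: domD_def)
qed

text \<open>The product of two cosines splits into frequencies \<open>i - j\<close> and
  \<open>i + j\<close>. Positivity of the indices keeps the second one away from 0; the constant
  \<open>phi 0\<close> would have squared norm 2.\<close>

lemma phi_orthonormal:
  assumes "i \<ge> 1" "j \<ge> 1"
  shows "(LINT y:domD|lborel. phi i y * phi j y) = (if i = j then 1 else 0)"
proof -
  have eq: "phi i y * phi j y =
      cos (of_int (int i - int j) * pi * y) + cos (of_int (int i + int j) * pi * y)" for y
  proof -
    have "phi i y * phi j y = 2 * (cos (lam i * y) * cos (lam j * y))"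
      by (simp add: phi_def)
    also have "\<dots> = cos (lam i * y - lam j * y) + cos (lam i * y + lam j * y)"
      by (simp add: cos_times_cos)
    finally show ?thesis by (simp add: lam_def algebra_simps)
  qed
  have int: "set_integrable lborel domD (\<lambda>y. cos (of_int k * pi * y))" for k :: int
    by (intro continuous_set_integrable_domD continuous_intros)
  have "(LINT y:domD|lborel. cos (of_int (int i + int j) * pi * y)) = 0"
    using assms by (intro LINT_domD_cos) auto
  moreover have "(LINT y:domD|lborel. cos (of_int (int i - int j) * pi * y)) = (if i = j then 1 else 0)"
  proof (cases "i = j")
    case True
    have "(LINT y:domD|lborel. (1::real)) = 1"
      by (simp add: domD_def set_lebesgue_integral_def)
    with True show ?thesis by simp
  qed (use LINT_domD_cos[of "int i - int j"] in simp)
  ultimately show ?thesis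
    unfolding eq by (subst set_integral_add(2)[OF int int]) simp
qed

text \<open>The eigenvalue of the fourth derivative plus \<mu> times the second derivative on
  \<open>eps k\<close>. It can be negative for small \<open>k\<close>.\<close>

definition rate :: "real \<Rightarrow> nat \<Rightarrow> real" where
  "rate \<mu> k = (lam k)\<^sup>2 * ((lam k)\<^sup>2 - \<mu>)"

text \<open>Expanding the square of \<open>(lam k)^2 - \<mu>\<close> gives a bound that treats all
  modes alike, including the growing ones; their growth is paid for by the factor
  \<open>exp (\<mu>^2 / 2 * r)\<close> in \<open>exp_rate_le\<close>.\<close>

lemma rate_ge: "rate \<mu> k \<ge> (lam k) ^ 4 / 2 - \<mu>\<^sup>2 / 2"
  using zero_le_power2[of "(lam k)\<^sup>2 - \<mu>"]
  by (simp add: rate_def power2_eq_square power4_eq_xxxx algebra_simps)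

lemma lam_ge: "lam k \<ge> real k"
  using mult_left_mono[of 1 pi "real k"] pi_gt3 by (simp add: lam_def)

lemma exp_rate_le:
  assumes "r \<ge> 0" shows "exp (- (rate \<mu> k * r)) \<le> exp (\<mu>\<^sup>2 / 2 * r) * exp (- ((lam k) ^ 4 / 2 * r))"
proof -
  have "((lam k) ^ 4 / 2 - \<mu>\<^sup>2 / 2) * r \<le> rate \<mu> k * r"
    by (intro mult_right_mono rate_ge assms)
  then show ?thesis by (simp add: exp_add[symmetric] algebra_simps)
qed

lemma exp_minus_le_inverse: "x > 0 \<Longrightarrow> exp (- x) \<le> 1 / (x::real)"
proof -
  assume "x > 0"
  moreover have "x \<le> exp x" using exp_ge_add_one_self[of x] by linarith
  ultimately show "exp (- x) \<le> 1 / x"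
    using frac_le[of 1 1 x "exp x"] by (simp add: exp_minus inverse_eq_divide)
qed

text \<open>Bounding \<open>exp (- x)\<close> by \<open>1 / x\<close> gains a fourth power of
  \<open>lam\<close>, so inverse cubes remain after the weight \<open>lam\<close>. The majorant
  blows up as \<open>r\<close> tends to 0, so the kernel is expanded only at fixed positive time
  distance.\<close>

lemma summable_Psi_coeffs:
  assumes "r > 0"
  shows "summable (\<lambda>j. lam (Suc j) * exp (- (rate \<mu> (Suc j) * r)))"
proof (rule summable_comparison_test')
  show "summable (\<lambda>j. exp (\<mu>\<^sup>2 / 2 * r) * (2 / r) * inverse (real (Suc j) ^ 3))"
    by (intro summable_mult, subst summable_Suc_iff) (rule inverse_power_summable, simp)
next
  fix j :: nat
  define l where "l = lam (Suc j)"
  have l: "l \<ge> real (Suc j)" "l > 0" using lam_ge[of "Suc j"] by (auto simp: l_def)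
  have x: "l ^ 4 / 2 * r > 0" using l assms by simp
  have "exp (- (l ^ 4 / 2 * r)) \<le> 1 / (l ^ 4 / 2 * r)"
    by (rule exp_minus_le_inverse[OF x])
  then have "l * (exp (\<mu>\<^sup>2 / 2 * r) * exp (- (l ^ 4 / 2 * r))) \<le> l * (exp (\<mu>\<^sup>2 / 2 * r) * (1 / (l ^ 4 / 2 * r)))"
    using l by (intro mult_left_mono) auto
  also have "\<dots> = exp (\<mu>\<^sup>2 / 2 * r) * (2 / r) * inverse (l ^ 3)"
    using l assms by (simp add: field_simps power_eq_if)
  also have "\<dots> \<le> exp (\<mu>\<^sup>2 / 2 * r) * (2 / r) * inverse (real (Suc j) ^ 3)"
    using l assms by (intro mult_left_mono le_imp_inverse_le power_mono) auto
  finally have "l * (exp (\<mu>\<^sup>2 / 2 * r) * exp (- (l ^ 4 / 2 * r))) \<le>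
     exp (\<mu>\<^sup>2 / 2 * r) * (2 / r) * inverse (real (Suc j) ^ 3)" .
  moreover have "l * exp (- (rate \<mu> (Suc j) * r)) \<le> l * (exp (\<mu>\<^sup>2 / 2 * r) * exp (- (l ^ 4 / 2 * r)))"
    using l exp_rate_le[of r \<mu> "Suc j"] assms by (intro mult_left_mono) (auto simp: l_def)
  ultimately have "l * exp (- (rate \<mu> (Suc j) * r)) \<le>
      exp (\<mu>\<^sup>2 / 2 * r) * (2 / r) * inverse (real (Suc j) ^ 3)"
    by (rule order.trans[rotated])
  then show "norm (lam (Suc j) * exp (- (rate \<mu> (Suc j) * r)))
      \<le> exp (\<mu>\<^sup>2 / 2 * r) * (2 / r) * inverse (real (Suc j) ^ 3)"
    using l by (simp add: l_def[symmetric])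
qed

lemma Psi_sums:
  assumes "r > 0"
  shows "(\<lambda>j. - (lam (Suc j) * exp (- (rate \<mu> (Suc j) * r)) * eps (Suc j) x) * phi (Suc j) y) sums Psi \<mu> r x y"
proof -
  have "summable (\<lambda>j. lam (Suc j) * exp (- (rate \<mu> (Suc j) * r)) * eps (Suc j) x * phi (Suc j) y)"
  proof (rule summable_comparison_test')
    show "summable (\<lambda>j. lam (Suc j) * exp (- (rate \<mu> (Suc j) * r)) * (2 * 2))"
      by (intro summable_mult2 summable_Psi_coeffs assms)
    fix j
    have "lam (Suc j) \<ge> 0" using lam_ge[of "Suc j"] by simp
    then show "norm (lam (Suc j) * exp (- (rate \<mu> (Suc j) * r)) * eps (Suc j) x * phi (Suc j) y)
      \<le> lam (Suc j) * exp (- (rate \<mu> (Suc j) * r)) * (2 * 2)"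
      using mult_mono[OF abs_eps_le[of "Suc j" x] abs_phi_le[of "Suc j" y]]
      by (simp add: abs_mult mult.assoc mult_left_mono)
  qed
  from sums_minus[OF summable_sums[OF this]] show ?thesis
    by (simp add: Psi_def rate_def)
qed

text \<open>Integration term by term is justified by a majorant that does not depend on
  \<open>y\<close>; orthonormality then leaves one term. Integrability of the limit comes from the
  same domination, without a separate study of \<open>Psi\<close>.\<close>

lemma Psi_phi_integral:
  assumes r: "r > 0" and i: "i \<ge> 1"
  shows "set_integrable lborel domD (\<lambda>y. Psi \<mu> r x y * phi i y)"
    and "(LINT y:domD|lborel. Psi \<mu> r x y * phi i y) = - (lam i * exp (- (rate \<mu> i * r)) * eps i x)"
proof -
  define c where "c j = lam (Suc j) * exp (- (rate \<mu> (Suc j) * r))" for j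
  define a where "a j = - (c j * eps (Suc j) x)" for j
  define f where "f j y = indicator domD y * (a j * (phi (Suc j) y * phi i y))" for j y
  have c: "summable c" "c j \<ge> 0" for j
    using summable_Psi_coeffs[OF r] lam_ge[of "Suc j"] by (auto simp: c_def[abs_def])
  \<comment> \<open>The 8 is the product of the bounds 2 for one sine and two cosines.\<close>
  have bound: "\<bar>f j y\<bar> \<le> c j * 8 * indicator domD y" for j y
  proof (cases "y \<in> domD")
    case True
    have "\<bar>eps (Suc j) x\<bar> * (\<bar>phi (Suc j) y\<bar> * \<bar>phi i y\<bar>) \<le> 2 * (2 * 2)"
      by (intro mult_mono abs_eps_le abs_phi_le) auto
    then show ?thesis using True c(2)[of j]
      by (simp add: f_def a_def abs_mult mult.assoc mult_left_mono)
  qed (simp add: f_def)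
  have int: "integrable lborel (f j)" for j
    using continuous_set_integrable_domD[of "\<lambda>y. a j * (phi (Suc j) y * phi i y)"]
    by (simp add: f_def[abs_def] set_integrable_def continuous_intros)
  have sumn: "summable (\<lambda>j. norm (f j y))" for y
    by (rule summable_comparison_test'[of "\<lambda>j. c j * 8 * indicator domD y"])
       (use bound c in \<open>auto intro: summable_mult2\<close>)
  have dom: "(\<integral>y. norm (f j y) \<partial>lborel) \<le> c j * 8" for j
  proof -
    have "(\<integral>y. norm (f j y) \<partial>lborel) \<le> (\<integral>y. c j * 8 * indicator domD y \<partial>lborel)"
      by (intro integral_mono integrable_norm int integrable_mult_right integrable_real_indicator)
         (use bound in \<open>auto simp: emeasure_domD\<close>)
    also have "\<dots> = c j * 8" by (simp add: measure_def emeasure_domD)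
    finally show ?thesis .
  qed
  have sumi: "summable (\<lambda>j. \<integral>y. norm (f j y) \<partial>lborel)"
    by (rule summable_comparison_test'[of "\<lambda>j. c j * 8"])
       (use dom c in \<open>auto intro: summable_mult2\<close>)
  have sf: "(\<Sum>j. f j y) = indicator domD y *\<^sub>R (Psi \<mu> r x y * phi i y)" for y
  proof -
    have "(\<lambda>j. a j * phi (Suc j) y) sums Psi \<mu> r x y"
      using Psi_sums[OF r, of \<mu> x y] by (simp add: a_def c_def)
    then have "(\<lambda>j. indicator domD y * (a j * phi (Suc j) y * phi i y)) sums
        (indicator domD y * (Psi \<mu> r x y * phi i y))"
      by (intro sums_mult sums_mult2)
    then show ?thesis by (simp add: f_def mult_ac sums_iff)
  qed
  show "set_integrable lborel domD (\<lambda>y. Psi \<mu> r x y * phi i y)"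
    unfolding set_integrable_def sf[symmetric]
    by (intro integrable_suminf int sumi AE_I2 sumn)
  have "(LINT y:domD|lborel. Psi \<mu> r x y * phi i y) = (\<Sum>j. \<integral>y. f j y \<partial>lborel)"
    unfolding set_lebesgue_integral_def sf[symmetric]
    by (intro integral_suminf int sumi AE_I2 sumn)
  \<comment> \<open>The series starts at \<open>Suc 0\<close>, so mode \<open>i\<close> sits at
    position \<open>i - 1\<close>.\<close>
  also have "(\<integral>y. f j y \<partial>lborel) = (if j = i - 1 then a (i - 1) else 0)" for j
  proof -
    have "(\<integral>y. f j y \<partial>lborel) = a j * (LINT y:domD|lborel. phi (Suc j) y * phi i y)"
      unfolding f_def set_lebesgue_integral_def real_scaleR_def
      by (subst integral_mult_right_zero[symmetric]) (simp add: mult_ac)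
    also have "\<dots> = a j * (if Suc j = i then 1 else 0)"
      using i by (subst phi_orthonormal) auto
    finally show ?thesis using i by auto
  qed
  then have "(\<Sum>j. \<integral>y. f j y \<partial>lborel) = a (i - 1)"
    using sums_single[of "i - 1" "\<lambda>_. a (i - 1)"] by (simp add: sums_iff eq_commute)
  finally show "(LINT y:domD|lborel. Psi \<mu> r x y * phi i y) = - (lam i * exp (- (rate \<mu> i * r)) * eps i x)"
    using i by (simp add: a_def c_def)
qed

text \<open>Parseval in the one direction needed. Partial sums satisfy it exactly, and Fatou's lemma
  passes to the pointwise limit, so neither completeness of the cosines nor square summability of
  the coefficients enters; the right side may be infinite.\<close>

lemma phi_series_norm_le:
  assumes "\<And>y. y \<in> domD \<Longrightarrow> (\<lambda>j. a j * phi (Suc j) y) sums f y"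
  shows "(\<integral>\<^sup>+y\<in>domD. ennreal ((f y)\<^sup>2) \<partial>lborel) \<le> (\<Sum>j. ennreal ((a j)\<^sup>2))"
proof -
  define p where "p n y = (\<Sum>j<n. a j * phi (Suc j) y)" for n y
  have [measurable]: "p n \<in> borel_measurable borel" for n unfolding p_def by measurable
  have int: "set_integrable lborel domD (\<lambda>y. (a j * phi (Suc j) y) * (a l * phi (Suc l) y))" for j l
    by (intro continuous_set_integrable_domD continuous_intros)
  have pint: "set_integrable lborel domD (\<lambda>y. (p n y)\<^sup>2)" for n
    unfolding p_def by (intro continuous_set_integrable_domD continuous_intros)
  have norm: "(LINT y:domD|lborel. (p n y)\<^sup>2) = (\<Sum>j<n. (a j)\<^sup>2)" for n
  proof -
    have "(LINT y:domD|lborel. (p n y)\<^sup>2) =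
        (LINT y:domD|lborel. \<Sum>j<n. \<Sum>l<n. (a j * phi (Suc j) y) * (a l * phi (Suc l) y))"
      by (simp add: p_def power2_eq_square sum_product)
    also have "\<dots> = (\<Sum>j<n. LINT y:domD|lborel. \<Sum>l<n. (a j * phi (Suc j) y) * (a l * phi (Suc l) y))"
      by (intro set_integral_finite_sum set_integrable_finite_sum int)
    also have "\<dots> = (\<Sum>j<n. \<Sum>l<n. LINT y:domD|lborel. (a j * phi (Suc j) y) * (a l * phi (Suc l) y))"
      by (intro sum.cong refl set_integral_finite_sum int)
    also have "\<dots> = (\<Sum>j<n. \<Sum>l<n. a j * a l * (LINT y:domD|lborel. phi (Suc j) y * phi (Suc l) y))"
    proof -
      have "(LINT y:domD|lborel. (a j * phi (Suc j) y) * (a l * phi (Suc l) y)) =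
        a j * a l * (LINT y:domD|lborel. phi (Suc j) y * phi (Suc l) y)" for j l
        unfolding set_lebesgue_integral_def real_scaleR_def
        by (subst integral_mult_right_zero[symmetric]) (simp add: mult_ac)
      then show ?thesis by simp
    qed
    also have "\<dots> = (\<Sum>j<n. \<Sum>l<n. if l = j then a j * a j else 0)"
      by (intro sum.cong refl) (subst phi_orthonormal, auto)
    also have "\<dots> = (\<Sum>j<n. (a j)\<^sup>2)" by (simp add: power2_eq_square)
    finally show ?thesis .
  qed
  have pn: "(\<integral>\<^sup>+y\<in>domD. ennreal ((p n y)\<^sup>2) \<partial>lborel) \<le> (\<Sum>j. ennreal ((a j)\<^sup>2))" for n
  proof -
    have "(\<integral>\<^sup>+y\<in>domD. ennreal ((p n y)\<^sup>2) \<partial>lborel) = (\<integral>\<^sup>+y. ennreal (indicator domD y *\<^sub>R (p n y)\<^sup>2) \<partial>lborel)"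
      by (intro nn_integral_cong) (auto simp: indicator_def)
    also have "\<dots> = ennreal (\<Sum>j<n. (a j)\<^sup>2)"
      using pint[of n] norm[of n]
      by (subst nn_integral_eq_integral) (auto simp: set_integrable_def set_lebesgue_integral_def)
    also have "\<dots> = (\<Sum>j<n. ennreal ((a j)\<^sup>2))" by (simp add: sum_ennreal)
    also have "\<dots> \<le> (\<Sum>j. ennreal ((a j)\<^sup>2))" by (intro sum_le_suminf) auto
    finally show ?thesis .
  qed
  have "(\<integral>\<^sup>+y\<in>domD. ennreal ((f y)\<^sup>2) \<partial>lborel) =
      (\<integral>\<^sup>+y. liminf (\<lambda>n. ennreal ((p n y)\<^sup>2) * indicator domD y) \<partial>lborel)"
  proof (intro nn_integral_cong)
    fix y
    show "ennreal ((f y)\<^sup>2) * indicator domD y = liminf (\<lambda>n. ennreal ((p n y)\<^sup>2) * indicator domD y)"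
    proof (cases "y \<in> domD")
      case True
      have "(\<lambda>n. p n y) \<longlonglongrightarrow> f y" using assms[OF True] by (simp add: sums_def p_def)
      then have "(\<lambda>n. ennreal ((p n y)\<^sup>2)) \<longlonglongrightarrow> ennreal ((f y)\<^sup>2)"
        by (intro tendsto_ennrealI tendsto_intros)
      then have "liminf (\<lambda>n. ennreal ((p n y)\<^sup>2)) = ennreal ((f y)\<^sup>2)"
        by (rule lim_imp_Liminf[OF trivial_limit_sequentially])
      then show ?thesis using True by simp
    qed (simp add: Liminf_const)
  qed
  also have "\<dots> \<le> liminf (\<lambda>n. \<integral>\<^sup>+y\<in>domD. ennreal ((p n y)\<^sup>2) \<partial>lborel)"
    by (rule nn_integral_liminf) measurable
  also have "\<dots> \<le> liminf (\<lambda>_::nat. \<Sum>j. ennreal ((a j)\<^sup>2))"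
    by (intro Liminf_mono always_eventually allI pn)
  also have "\<dots> = (\<Sum>j. ennreal ((a j)\<^sup>2))"
    by (rule Liminf_const[OF trivial_limit_sequentially])
  finally show ?thesis .
qed

subsection \<open>Averaging over time slabs\<close>

text \<open>\<open>m\<close> is the orthogonal projection of \<open>f\<close> onto constants: the
  squared deviation integrates to the integral of \<open>f^2\<close> minus
  \<open>(b - a) * m^2\<close>. For the second bound, a mean cannot be farther from a value of
  \<open>f\<close> than the oscillation \<open>w\<close>.\<close>

lemma interval_average_bounds:
  fixes f :: "real \<Rightarrow> real"
  assumes "a < b" and f[measurable]: "f \<in> borel_measurable borel"
    and B: "\<And>s. s \<in> {a<..<b} \<Longrightarrow> \<bar>f s\<bar> \<le> B"
  defines "m \<equiv> 1 / (b - a) * (LINT s:{a<..<b}|lborel. f s)"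
  shows "(\<integral>\<^sup>+s\<in>{a<..<b}. ennreal ((f s - m)\<^sup>2) \<partial>lborel) \<le> (\<integral>\<^sup>+s\<in>{a<..<b}. ennreal ((f s)\<^sup>2) \<partial>lborel)"
    and "(\<And>s s'. s \<in> {a<..<b} \<Longrightarrow> s' \<in> {a<..<b} \<Longrightarrow> \<bar>f s - f s'\<bar> \<le> w) \<Longrightarrow>
      (\<integral>\<^sup>+s\<in>{a<..<b}. ennreal ((f s - m)\<^sup>2) \<partial>lborel) \<le> ennreal ((b - a) * w\<^sup>2)"
proof -
  let ?A = "{a<..<b}"
  have const: "set_integrable lborel ?A (\<lambda>_. c)" for c :: real
    using \<open>a < b\<close> by (simp add: set_integrable_def)
  have constI: "(LINT s:?A|lborel. c) = (b - a) * c" for c :: real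
    using \<open>a < b\<close> by (simp add: set_lebesgue_integral_def)
  have int: "set_integrable lborel ?A g"
    if "g \<in> borel_measurable borel" "\<And>s. s \<in> ?A \<Longrightarrow> \<bar>g s\<bar> \<le> C" for g :: "real \<Rightarrow> real" and C
    by (rule set_integrable_bound[OF const[of C]])
       (use that in \<open>auto simp: set_borel_measurable_def intro!: AE_I2 order_trans[OF that(2) abs_ge_self]\<close>)
  have fint: "set_integrable lborel ?A f" using f B by (rule int)
  have sqint: "set_integrable lborel ?A (\<lambda>s. (f s)\<^sup>2)"
  proof (rule int)
    fix s assume "s \<in> ?A"
    then show "\<bar>(f s)\<^sup>2\<bar> \<le> B\<^sup>2" using power_mono[OF B[of s], of 2] by simp
  qed measurable
  have m: "(LINT s:?A|lborel. f s) = (b - a) * m" using \<open>a < b\<close> by (simp add: m_def)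
  have nn: "(\<integral>\<^sup>+s\<in>?A. ennreal ((g s)\<^sup>2) \<partial>lborel) = ennreal (LINT s:?A|lborel. (g s)\<^sup>2)"
    if "set_integrable lborel ?A (\<lambda>s. (g s)\<^sup>2)" for g :: "real \<Rightarrow> real"
  proof -
    have "(\<integral>\<^sup>+s\<in>?A. ennreal ((g s)\<^sup>2) \<partial>lborel) = (\<integral>\<^sup>+s. ennreal (indicator ?A s *\<^sub>R (g s)\<^sup>2) \<partial>lborel)"
      by (intro nn_integral_cong) (auto simp: indicator_def)
    also have "\<dots> = ennreal (LINT s:?A|lborel. (g s)\<^sup>2)"
      unfolding set_lebesgue_integral_def
      by (intro nn_integral_eq_integral) (use that in \<open>auto simp: set_integrable_def\<close>)
    finally show ?thesis .
  qed
  have eq: "(f s - m)\<^sup>2 = (f s)\<^sup>2 - 2 * m * f s + m\<^sup>2" for s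
    by (simp add: power2_eq_square algebra_simps)
  have cint: "set_integrable lborel ?A (\<lambda>s. (f s - m)\<^sup>2)"
    unfolding eq by (intro set_integral_add(1) set_integral_diff(1) sqint set_integrable_mult_right fint const)
  have "(LINT s:?A|lborel. (f s - m)\<^sup>2) = (LINT s:?A|lborel. (f s)\<^sup>2) - 2 * m * ((b - a) * m) + (b - a) * m\<^sup>2"
    unfolding eq
    by (subst set_integral_add(2), intro set_integral_diff(1) sqint set_integrable_mult_right fint, rule const,
        subst set_integral_diff(2)[OF sqint], intro set_integrable_mult_right fint)
       (simp add: constI m)
  also have "\<dots> = (LINT s:?A|lborel. (f s)\<^sup>2) - (b - a) * m\<^sup>2" by (simp add: power2_eq_square algebra_simps)
  also have "\<dots> \<le> (LINT s:?A|lborel. (f s)\<^sup>2)" using \<open>a < b\<close> by simp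
  finally show "(\<integral>\<^sup>+s\<in>?A. ennreal ((f s - m)\<^sup>2) \<partial>lborel) \<le> (\<integral>\<^sup>+s\<in>?A. ennreal ((f s)\<^sup>2) \<partial>lborel)"
    by (simp add: nn cint sqint ennreal_leI)
  assume w: "\<And>s s'. s \<in> ?A \<Longrightarrow> s' \<in> ?A \<Longrightarrow> \<bar>f s - f s'\<bar> \<le> w"
  have dev: "\<bar>f s - m\<bar> \<le> w" if s: "s \<in> ?A" for s
  proof -
    have "(LINT s':?A|lborel. f s') \<le> (LINT s':?A|lborel. f s + w)"
      by (intro set_integral_mono fint const) (use w[OF s] in \<open>force simp: abs_le_iff\<close>)
    then have "(b - a) * m \<le> (b - a) * (f s + w)" by (simp only: m constI)
    then have 1: "m \<le> f s + w" using \<open>a < b\<close> by simp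
    have "(LINT s':?A|lborel. f s - w) \<le> (LINT s':?A|lborel. f s')"
      by (intro set_integral_mono fint const) (use w[OF s] in \<open>force simp: abs_le_iff\<close>)
    then have "(b - a) * (f s - w) \<le> (b - a) * m" by (simp only: m constI)
    then have "f s - w \<le> m" using \<open>a < b\<close> by simp
    with 1 show ?thesis by linarith
  qed
  have "(LINT s:?A|lborel. (f s - m)\<^sup>2) \<le> (LINT s:?A|lborel. w\<^sup>2)"
  proof (intro set_integral_mono cint const)
    fix s assume "s \<in> ?A"
    from power_mono[OF dev[OF this], of 2] show "(f s - m)\<^sup>2 \<le> w\<^sup>2" by simp
  qed
  then show "(\<integral>\<^sup>+s\<in>?A. ennreal ((f s - m)\<^sup>2) \<partial>lborel) \<le> ennreal ((b - a) * w\<^sup>2)"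
    by (simp add: nn cint constI ennreal_leI)
qed

definition slab_avg :: "real \<Rightarrow> nat \<Rightarrow> (real \<Rightarrow> real) \<Rightarrow> nat \<Rightarrow> real" where
  "slab_avg T N f n = 1 / (T / real N) * (LINT s:time_slab T N n|lborel. f s)"

lemma time_slab_borel [measurable]: "time_slab T N n \<in> sets borel"
  by (simp add: time_slab_def)

lemma time_slab_subset:
  assumes "T > 0" "N \<ge> 1" "n \<in> {1..N}"
  shows "time_slab T N n \<subseteq> {0<..<T}"
proof -
  have "real n * (T / real N) \<le> real N * (T / real N)"
    using assms by (intro mult_right_mono) auto
  also have "\<dots> = T" using assms by simp
  finally have "real n * (T / real N) \<le> T" .
  moreover have "0 \<le> real (n - 1) * (T / real N)" using assms by simp
  ultimately show ?thesis
    unfolding time_slab_def by (intro subsetI) (simp only: greaterThanLessThan_iff, linarith)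
qed

lemma time_slab_unique:
  assumes "T > 0" "N \<ge> 1" "n \<ge> 1" "n' \<ge> 1" "s \<in> time_slab T N n" "s \<in> time_slab T N n'"
  shows "n = n'"
proof -
  have "n < n' + 1" if "n \<ge> 1" "n' \<ge> 1" "s \<in> time_slab T N n" "s \<in> time_slab T N n'" for n n'
  proof -
    have "real (n - 1) * (T / real N) < real n' * (T / real N)"
      using that by (auto simp: time_slab_def)
    then have "real (n - 1) < real n'"
      using assms by (subst (asm) mult_less_cancel_right_pos) auto
    then show ?thesis using that by linarith
  qed
  from this[of n n'] this[of n' n] assms show ?thesis by simp
qed

lemma time_slab_cover:
  assumes "T > 0" "N \<ge> 1" "s \<in> {0..T}" "s \<notin> (\<lambda>n. real n * (T / real N)) ` {0..N}"
  shows "\<exists>n\<in>{1..N}. s \<in> time_slab T N n"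
proof -
  define d where "d = T / real N"
  have d: "d > 0" "real N * d = T" using assms by (auto simp: d_def)
  \<comment> \<open>Slab \<open>n\<close> ends at \<open>n * d\<close>, so rounding up finds it. The
    slabs are open, whence the exclusion of all grid times, 0 and \<open>T\<close> included.\<close>
  define n where "n = nat \<lceil>s / d\<rceil>"
  have s0: "s \<noteq> 0" using assms(4) by (auto simp: image_iff)
  then have "s / d > 0" using assms d by auto
  then have n1: "n \<ge> 1" unfolding n_def by linarith
  have le: "s / d \<le> real n" and gt: "real n - 1 < s / d"
    unfolding n_def using \<open>s / d > 0\<close> by linarith+
  have "s / d \<le> real N" using assms d by (simp add: field_simps)
  then have nN: "n \<le> N" using gt by linarith
  have "s \<le> real n * d" "real (n - 1) * d < s" using le gt d n1 by (auto simp: field_simps of_nat_diff)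
  moreover have "s \<noteq> real n * d" using assms(4) nN by (auto simp: d_def)
  ultimately show ?thesis using n1 nN by (intro bexI[of _ n]) (auto simp: time_slab_def d_def)
qed

text \<open>The grid is finite and hence null; off it exactly one slab contains \<open>s\<close> and
  the sum collapses. The values \<open>m\<close> stay free: averages give the projection error,
  zeros split the plain energy.\<close>

lemma nn_integral_time_slabs:
  fixes f :: "real \<Rightarrow> real"
  assumes T: "T > 0" "N \<ge> 1" and [measurable]: "f \<in> borel_measurable borel"
  shows "(\<integral>\<^sup>+s\<in>{0..T}. ennreal ((f s - (\<Sum>n\<in>{1..N}. indicator (time_slab T N n) s * m n))\<^sup>2) \<partial>lborel) =
     (\<Sum>n\<in>{1..N}. \<integral>\<^sup>+s\<in>time_slab T N n. ennreal ((f s - m n)\<^sup>2) \<partial>lborel)"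
proof -
  let ?grid = "(\<lambda>n. real n * (T / real N)) ` {0..N}"
  have "?grid \<in> null_sets lborel" by (intro finite_imp_null_set_lborel) auto
  then have "AE s in lborel. s \<notin> ?grid" by (rule AE_not_in)
  then have "AE s in lborel.
    ennreal ((f s - (\<Sum>n\<in>{1..N}. indicator (time_slab T N n) s * m n))\<^sup>2) * indicator {0..T} s =
    (\<Sum>n\<in>{1..N}. ennreal ((f s - m n)\<^sup>2) * indicator (time_slab T N n) s)"
  proof eventually_elim
    fix s assume s: "s \<notin> ?grid"
    show "ennreal ((f s - (\<Sum>n\<in>{1..N}. indicator (time_slab T N n) s * m n))\<^sup>2) * indicator {0..T} s =
      (\<Sum>n\<in>{1..N}. ennreal ((f s - m n)\<^sup>2) * indicator (time_slab T N n) s)"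
    proof (cases "s \<in> {0..T}")
      case True
      then obtain l where l: "l \<in> {1..N}" "s \<in> time_slab T N l" using time_slab_cover[OF T _ s] by auto
      have mem: "s \<in> time_slab T N n \<longleftrightarrow> n = l" if "n \<in> {1..N}" for n
      proof
        assume "s \<in> time_slab T N n"
        then show "n = l" using time_slab_unique[OF T _ _ _ l(2), of n] l(1) that by simp
      qed (use l in simp)
      have "(\<Sum>n\<in>{1..N}. indicator (time_slab T N n) s * m n) = (\<Sum>n\<in>{1..N}. if n = l then m n else 0)"
        by (intro sum.cong refl) (simp add: indicator_def mem)
      moreover have "(\<Sum>n\<in>{1..N}. ennreal ((f s - m n)\<^sup>2) * indicator (time_slab T N n) s) =
         (\<Sum>n\<in>{1..N}. if n = l then ennreal ((f s - m n)\<^sup>2) else 0)"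
        by (intro sum.cong refl) (simp add: indicator_def mem)
      ultimately show ?thesis using l True by simp
    next
      case False
      then have "indicator (time_slab T N n) s = (0::ennreal)" if "n \<in> {1..N}" for n
        using time_slab_subset[OF T that] by (auto simp: indicator_def)
      then show ?thesis using False by simp
    qed
  qed
  then have "(\<integral>\<^sup>+s\<in>{0..T}. ennreal ((f s - (\<Sum>n\<in>{1..N}. indicator (time_slab T N n) s * m n))\<^sup>2) \<partial>lborel) =
    (\<integral>\<^sup>+s. (\<Sum>n\<in>{1..N}. ennreal ((f s - m n)\<^sup>2) * indicator (time_slab T N n) s) \<partial>lborel)"
    by (rule nn_integral_cong_AE)
  also have "\<dots> = (\<Sum>n\<in>{1..N}. \<integral>\<^sup>+s\<in>time_slab T N n. ennreal ((f s - m n)\<^sup>2) \<partial>lborel)"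
    by (intro nn_integral_sum) measurable
  finally show ?thesis .
qed

text \<open>\<open>G\<close> encodes bounded variation without mentioning partitions: its increments
  dominate those of \<open>f\<close>, so \<open>G T - G 0\<close> bounds the total variation. The
  oscillation of \<open>f\<close> on a slab is at most the increment of \<open>G\<close> over it,
  and these increments telescope.\<close>

lemma slab_projection_error:
  fixes f :: "real \<Rightarrow> real"
  assumes T: "T > 0" "N \<ge> 1" and f: "f \<in> borel_measurable borel"
    and B: "\<And>s. s \<in> {0..T} \<Longrightarrow> \<bar>f s\<bar> \<le> B"
  defines "err \<equiv> \<integral>\<^sup>+s\<in>{0..T}.
     ennreal ((f s - (\<Sum>n\<in>{1..N}. indicator (time_slab T N n) s * slab_avg T N f n))\<^sup>2) \<partial>lborel"
  shows "err \<le> (\<integral>\<^sup>+s\<in>{0..T}. ennreal ((f s)\<^sup>2) \<partial>lborel)"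
    and "(\<And>s s'. 0 \<le> s \<Longrightarrow> s \<le> s' \<Longrightarrow> s' \<le> T \<Longrightarrow> \<bar>f s' - f s\<bar> \<le> G s' - G s) \<Longrightarrow>
      err \<le> ennreal (T / real N * (G T - G 0)\<^sup>2)"
proof -
  define d where "d = T / real N"
  have d: "d > 0" "real N * d = T" using assms by (auto simp: d_def)
  have slab: "time_slab T N n = {real (n - 1) * d <..< real n * d}" for n
    by (simp add: time_slab_def d_def)
  have len: "real n * d - real (n - 1) * d = d" if "n \<in> {1..N}" for n
    using that by (simp add: of_nat_diff algebra_simps)
  have lt: "real (n - 1) * d < real n * d" if "n \<in> {1..N}" for n
    using len[OF that] d by linarith
  have avg: "slab_avg T N f n = 1 / (real n * d - real (n - 1) * d) *
     (LINT s:{real (n - 1) * d <..< real n * d}|lborel. f s)" if "n \<in> {1..N}" for n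
    unfolding slab_avg_def slab len[OF that] by (simp add: d_def)
  have Bn: "\<bar>f s\<bar> \<le> B" if "n \<in> {1..N}" "s \<in> {real (n - 1) * d <..< real n * d}" for n s
    using B[of s] time_slab_subset[OF T that(1)] that(2) by (auto simp: slab)
  have err: "err = (\<Sum>n\<in>{1..N}. \<integral>\<^sup>+s\<in>time_slab T N n. ennreal ((f s - slab_avg T N f n)\<^sup>2) \<partial>lborel)"
    unfolding err_def by (rule nn_integral_time_slabs[OF T f])
  also have "\<dots> \<le> (\<Sum>n\<in>{1..N}. \<integral>\<^sup>+s\<in>time_slab T N n. ennreal ((f s)\<^sup>2) \<partial>lborel)"
  proof (rule sum_mono)
    fix n assume n: "n \<in> {1..N}"
    show "(\<integral>\<^sup>+s\<in>time_slab T N n. ennreal ((f s - slab_avg T N f n)\<^sup>2) \<partial>lborel) \<le>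
      (\<integral>\<^sup>+s\<in>time_slab T N n. ennreal ((f s)\<^sup>2) \<partial>lborel)"
      unfolding avg[OF n] slab by (rule interval_average_bounds(1)[OF lt[OF n] f Bn[OF n]])
  qed
  also have "\<dots> = (\<integral>\<^sup>+s\<in>{0..T}. ennreal ((f s)\<^sup>2) \<partial>lborel)"
    using nn_integral_time_slabs[OF T f, of "\<lambda>_. 0"] by simp
  finally show "err \<le> (\<integral>\<^sup>+s\<in>{0..T}. ennreal ((f s)\<^sup>2) \<partial>lborel)" .
  assume G: "\<And>s s'. 0 \<le> s \<Longrightarrow> s \<le> s' \<Longrightarrow> s' \<le> T \<Longrightarrow> \<bar>f s' - f s\<bar> \<le> G s' - G s"
  have mono: "G s \<le> G s'" if "0 \<le> s" "s \<le> s'" "s' \<le> T" for s s'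
    using G[OF that] by linarith
  define w where "w n = G (real n * d) - G (real (n - 1) * d)" for n
  have le_T: "real n * d \<le> T" if "n \<le> N" for n
    using that d by (metis mult_right_mono less_imp_le of_nat_le_iff)
  have w0: "w n \<ge> 0" if "n \<in> {1..N}" for n
    unfolding w_def using mono[of "real (n - 1) * d" "real n * d"] lt[OF that] le_T[of n] d that by simp
  have sum_w: "(\<Sum>n\<in>{1..l}. w n) = G (real l * d) - G 0" for l
    by (induction l) (simp_all add: w_def)
  have osc: "\<bar>f s - f s'\<bar> \<le> w n"
    if n: "n \<in> {1..N}" and "s \<in> time_slab T N n" "s' \<in> time_slab T N n" for n s s'
  proof -
    have "\<bar>f s - f s'\<bar> \<le> w n" if "s \<in> time_slab T N n" "s' \<in> time_slab T N n" "s \<le> s'" for s s'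
    proof -
      have "0 \<le> real (n - 1) * d" using d by simp
      then have "\<bar>f s' - f s\<bar> \<le> G s' - G s" "G s' \<le> G (real n * d)" "G (real (n - 1) * d) \<le> G s"
        using that le_T[of n] n by (auto simp: slab intro!: G mono)
      then show ?thesis unfolding w_def by linarith
    qed
    from this[of s s'] this[of s' s] that show ?thesis by (cases "s \<le> s'") (auto simp: abs_minus_commute)
  qed
  have "err \<le> (\<Sum>n\<in>{1..N}. ennreal (d * (w n)\<^sup>2))"
    unfolding err
  proof (rule sum_mono)
    fix n assume n: "n \<in> {1..N}"
    have "(\<integral>\<^sup>+s\<in>{real (n - 1) * d <..< real n * d}. ennreal ((f s - slab_avg T N f n)\<^sup>2) \<partial>lborel) \<le>
      ennreal ((real n * d - real (n - 1) * d) * (w n)\<^sup>2)"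
      unfolding avg[OF n]
      by (rule interval_average_bounds(2)[OF lt[OF n] f Bn[OF n]]) (use osc[OF n] slab in auto)
    then show "(\<integral>\<^sup>+s\<in>time_slab T N n. ennreal ((f s - slab_avg T N f n)\<^sup>2) \<partial>lborel) \<le>
      ennreal (d * (w n)\<^sup>2)" unfolding slab len[OF n] .
  qed
  also have "\<dots> = ennreal (\<Sum>n\<in>{1..N}. d * (w n)\<^sup>2)" using d by (intro sum_ennreal) simp
  also have "\<dots> \<le> ennreal (d * (G T - G 0)\<^sup>2)"
  proof (rule ennreal_leI)
    \<comment> \<open>A sum of squares of nonnegative numbers is at most the square of the sum.
      Bounding each \<open>w n\<close> by the full variation would cost a factor \<open>N\<close>
      and destroy the gain from \<open>d\<close>.\<close>
    have "(\<Sum>n\<in>{1..N}. (w n)\<^sup>2) \<le> (\<Sum>n\<in>{1..N}. w n * (\<Sum>l\<in>{1..N}. w l))"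
      unfolding power2_eq_square by (intro sum_mono mult_left_mono member_le_sum w0) auto
    also have "\<dots> = (G T - G 0)\<^sup>2"
      using sum_w[of N] d by (simp add: sum_distrib_right[symmetric] power2_eq_square)
    finally show "(\<Sum>n\<in>{1..N}. d * (w n)\<^sup>2) \<le> d * (G T - G 0)\<^sup>2"
      using d by (simp add: sum_distrib_left[symmetric])
  qed
  finally show "err \<le> ennreal (T / real N * (G T - G 0)\<^sup>2)" by (simp add: d_def)
qed

section \<open>Balancing the two bounds over the modes\<close>

lemma sum_inverse_squares_tail:
  "(\<Sum>j<n. if Suc j > K then 1 / (real (Suc j))\<^sup>2 else 0) \<le> 2 / real (K + 1)"
proof -
  \<comment> \<open>The induction needs the sharper bound with the subtracted
    \<open>2 / real (n + 1)\<close>; it telescopes because \<open>1 / x^2\<close> is at most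
    \<open>2 / x - 2 / (x + 1)\<close> for \<open>x\<close> at least 1.\<close>
  have "(\<Sum>j<n. if Suc j > K then 1 / (real (Suc j))\<^sup>2 else 0) \<le>
      (if n \<le> K then 0 else 2 / real (K + 1) - 2 / real (n + 1))"
  proof (induction n)
    case (Suc n)
    define x where "x = real n + 1"
    have x: "x \<ge> 1" by (simp add: x_def)
    have "1 / x\<^sup>2 = 2 / (x * (2 * x))" by (simp add: power2_eq_square)
    also have "\<dots> \<le> 2 / (x * (x + 1))" using x by (intro divide_left_mono mult_left_mono mult_pos_pos) auto
    also have "\<dots> = 2 / x - 2 / (x + 1)" using x by (simp add: field_simps)
    finally have "1 / (real (Suc n))\<^sup>2 \<le> 2 / real (n + 1) - 2 / real (n + 2)"
      by (simp add: x_def add_ac)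
    then show ?case using Suc by (cases "n = K") (auto split: if_splits simp: add_ac)
  qed simp
  also have "\<dots> \<le> 2 / real (K + 1)" by simp
  finally show ?thesis .
qed

text \<open>A mode beyond either \<open>K\<close> or \<open>M\<close> is charged the first bound,
  every other one the second. The two tails are added instead of being merged at the smaller cutoff,
  which is where \<open>2 * E\<close> comes from on each of the two terms.\<close>

lemma suminf_min_rate_le:
  fixes b :: "nat \<Rightarrow> ennreal"
  assumes "E \<ge> 0" "A \<ge> 0" "d > 0" "M \<ge> 1"
    and b1: "\<And>j. b j \<le> ennreal (E / (real (Suc j))\<^sup>2)"
    and b2: "\<And>j. Suc j \<le> M \<Longrightarrow> b j \<le> ennreal (A * (real (Suc j))\<^sup>2 * d)"
  shows "(\<Sum>j. b j) \<le> ennreal ((A + 2 * E) * (d powr (1 / 4) + 1 / real M))"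
proof (rule suminf_le_const)
  fix n
  define q where "q = d powr (1 / 4)"
  have q: "q > 0" "q ^ 4 = d" using assms
    by (simp_all add: q_def powr_power)
  \<comment> \<open>With \<open>q^4 = d\<close>, this cutoff makes \<open>d * K^3\<close> at most
    \<open>q\<close>, while the tail beyond it is at most \<open>2 * q\<close>. For
    \<open>d > 1\<close> it is 0 and all modes fall into the tail.\<close>
  define K where "K = nat \<lfloor>1 / q\<rfloor>"
  have K: "real K \<le> 1 / q" "1 / q < real K + 1"
    using q unfolding K_def by (auto simp: of_nat_nat)
  define t where "t L j = (if Suc j > L then 1 / (real (Suc j))\<^sup>2 else 0)" for L j
  define h where "h j = (if Suc j \<le> K then A * (real K)\<^sup>2 * d else 0)" for j
  have "b j \<le> ennreal (h j + E * t K j + E * t M j)" for j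
  proof -
    consider "Suc j \<le> M" "Suc j \<le> K" | "Suc j > M" | "Suc j > K" by linarith
    then show ?thesis
    proof cases
      case 1
      have "A * (real (Suc j))\<^sup>2 * d \<le> h j + E * t K j + E * t M j"
        using 1 assms by (auto simp: h_def t_def intro!: mult_right_mono mult_left_mono power_mono)
      then show ?thesis using b2[OF 1(1)] by (meson ennreal_leI order.trans)
    next
      case 2
      then have "E / (real (Suc j))\<^sup>2 \<le> h j + E * t K j + E * t M j"
        using assms by (auto simp: h_def t_def)
      then show ?thesis using b1[of j] by (meson ennreal_leI order.trans)
    next
      case 3
      then have "E / (real (Suc j))\<^sup>2 \<le> h j + E * t K j + E * t M j"
        using assms by (auto simp: h_def t_def)
      then show ?thesis using b1[of j] by (meson ennreal_leI order.trans)
    qed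
  qed
  then have "(\<Sum>j<n. b j) \<le> (\<Sum>j<n. ennreal (h j + E * t K j + E * t M j))" by (rule sum_mono)
  also have "\<dots> = ennreal (\<Sum>j<n. h j + E * t K j + E * t M j)"
    using assms by (intro sum_ennreal) (auto simp: h_def t_def)
  also have "\<dots> \<le> ennreal ((A + 2 * E) * (q + 1 / real M))"
  proof (rule ennreal_leI)
    have "(\<Sum>j<n. h j) = (\<Sum>j\<in>{..<n} \<inter> {..<K}. A * (real K)\<^sup>2 * d)"
      unfolding h_def by (subst sum.inter_restrict) (auto simp: Suc_le_eq)
    also have "\<dots> \<le> (\<Sum>j\<in>{..<K}. A * (real K)\<^sup>2 * d)"
      using assms by (intro sum_mono2) auto
    also have "\<dots> = A * d * real K ^ 3" by (simp add: power2_eq_square power3_eq_cube)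
    also have "\<dots> \<le> A * d * (1 / q) ^ 3" using assms K by (intro mult_left_mono power_mono) auto
    also have "\<dots> = A * q" using q by (simp add: q(2)[symmetric] power_eq_if)
    finally have 1: "(\<Sum>j<n. h j) \<le> A * q" .
    have "(\<Sum>j<n. t K j) \<le> 2 / real (K + 1)" unfolding t_def by (rule sum_inverse_squares_tail)
    also have "\<dots> \<le> 2 * q" using K q by (simp add: field_simps)
    finally have 2: "(\<Sum>j<n. t K j) \<le> 2 * q" .
    have "(\<Sum>j<n. t M j) \<le> 2 / real (M + 1)" unfolding t_def by (rule sum_inverse_squares_tail)
    also have "\<dots> \<le> 2 * (1 / real M)" using assms by (simp add: field_simps)
    finally have 3: "(\<Sum>j<n. t M j) \<le> 2 * (1 / real M)" .
    have "(\<Sum>j<n. h j + E * t K j + E * t M j) = (\<Sum>j<n. h j) + E * (\<Sum>j<n. t K j) + E * (\<Sum>j<n. t M j)"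
      by (simp add: sum.distrib sum_distrib_left)
    also have "\<dots> \<le> A * q + E * (2 * q) + E * (2 * (1 / real M))"
      using assms by (intro add_mono mult_left_mono 1 2 3) auto
    also have "\<dots> \<le> (A + 2 * E) * (q + 1 / real M)"
      using assms by (simp add: algebra_simps)
    finally show "(\<Sum>j<n. h j + E * t K j + E * t M j) \<le> (A + 2 * E) * (q + 1 / real M)" .
  qed
  finally show "(\<Sum>j<n. b j) \<le> ennreal ((A + 2 * E) * (d powr (1 / 4) + 1 / real M))"
    by (simp add: q_def)
qed simp

subsection \<open>Convergence rate\<close>

text \<open>Up to the factor \<open>- lam k * eps k x\<close>, the \<open>k\<close>-th cosine
  coefficient of the kernel in \<open>y\<close>, cut off at \<open>t\<close> by the same strict
  inequality as in \<open>mild_solution\<close>. It is not cut off at 0, so the estimates are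
  confined to nonnegative times.\<close>

definition mode :: "real \<Rightarrow> real \<Rightarrow> nat \<Rightarrow> real \<Rightarrow> real" where
  "mode \<mu> t k s = (if s < t then exp (- (rate \<mu> k * (t - s))) else 0)"

lemma mode_measurable [measurable]: "mode \<mu> t k \<in> borel_measurable borel"
  unfolding mode_def by measurable

lemma exp_rate_bound:
  assumes "0 \<le> r" "r \<le> T"
  shows "exp (- (rate \<mu> k * r)) \<le> exp (\<mu>\<^sup>2 / 2 * T)"
proof -
  have "exp (- (rate \<mu> k * r)) \<le> exp (\<mu>\<^sup>2 / 2 * r) * exp (- ((lam k) ^ 4 / 2 * r))"
    using assms by (intro exp_rate_le)
  also have "\<dots> \<le> exp (\<mu>\<^sup>2 / 2 * T) * 1"
    using assms by (intro mult_mono) (auto intro!: mult_left_mono)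
  finally show ?thesis by simp
qed

lemma abs_mode_le:
  assumes "0 \<le> s" "t \<le> T" "0 \<le> T"
  shows "\<bar>mode \<mu> t k s\<bar> \<le> exp (\<mu>\<^sup>2 / 2 * T)"
  using assms exp_rate_bound[of "t - s" T \<mu> k] by (simp add: mode_def)

text \<open>Squaring doubles the exponents and removes the halves of \<open>exp_rate_le\<close>;
  what is left decays at rate \<open>(lam k)^4\<close> away from \<open>t\<close>, so its integral
  is at most the reciprocal, whatever \<open>t\<close> is.\<close>

lemma mode_energy_le:
  assumes "0 \<le> t" "t \<le> T" "k \<ge> 1"
  shows "(\<integral>\<^sup>+s\<in>{0..T}. ennreal ((mode \<mu> t k s)\<^sup>2) \<partial>lborel) \<le> ennreal (exp (\<mu>\<^sup>2 * T) / (lam k) ^ 4)"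
proof -
  define l where "l = (lam k) ^ 4"
  have l: "l > 0" using lam_ge[of k] assms by (simp add: l_def)
  have le: "(mode \<mu> t k s)\<^sup>2 \<le> exp (\<mu>\<^sup>2 * T) * exp (- (l * (t - s)))" if "0 \<le> s" "s < t" for s
  proof -
    have "(mode \<mu> t k s)\<^sup>2 \<le> (exp (\<mu>\<^sup>2 / 2 * (t - s)) * exp (- (l / 2 * (t - s))))\<^sup>2"
      using exp_rate_le[of "t - s" \<mu> k] that by (intro power_mono) (auto simp: mode_def l_def)
    also have "\<dots> = exp (\<mu>\<^sup>2 * (t - s)) * exp (- (l * (t - s)))"
      by (simp add: power2_eq_square exp_add[symmetric] algebra_simps)
    also have "\<dots> \<le> exp (\<mu>\<^sup>2 * T) * exp (- (l * (t - s)))"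
      using that assms by (intro mult_right_mono) (auto intro!: mult_left_mono)
    finally show ?thesis .
  qed
  have "(\<integral>\<^sup>+s\<in>{0..T}. ennreal ((mode \<mu> t k s)\<^sup>2) \<partial>lborel) \<le>
      (\<integral>\<^sup>+s. ennreal (exp (\<mu>\<^sup>2 * T) * exp (- (l * (t - s)))) * indicator {0..t} s \<partial>lborel)"
  proof (rule nn_integral_mono)
    fix s
    show "ennreal ((mode \<mu> t k s)\<^sup>2) * indicator {0..T} s \<le>
        ennreal (exp (\<mu>\<^sup>2 * T) * exp (- (l * (t - s)))) * indicator {0..t} s"
    proof (cases "0 \<le> s \<and> s < t")
      case True
      then show ?thesis using le[of s] assms by (simp add: ennreal_leI)
    next
      case False
      then have *: "ennreal ((mode \<mu> t k s)\<^sup>2) * indicator {0..T} s = 0"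
        by (auto simp: mode_def indicator_def)
      show ?thesis unfolding * by simp
    qed
  qed
  also have "\<dots> = ennreal (exp (\<mu>\<^sup>2 * T) * exp (- (l * (t - t))) / l - exp (\<mu>\<^sup>2 * T) * exp (- (l * (t - 0))) / l)"
  proof (rule nn_integral_FTC_Icc[where F = "\<lambda>s. exp (\<mu>\<^sup>2 * T) * exp (- (l * (t - s))) / l"])
    fix s :: real
    show "((\<lambda>s. exp (\<mu>\<^sup>2 * T) * exp (- (l * (t - s))) / l) has_real_derivative
        exp (\<mu>\<^sup>2 * T) * exp (- (l * (t - s)))) (at s)"
      using l by (auto intro!: derivative_eq_intros)
  qed (use assms in auto)
  also have "\<dots> \<le> ennreal (exp (\<mu>\<^sup>2 * T) / l)" using l by (intro ennreal_leI) simp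
  finally show ?thesis by (simp add: l_def)
qed

text \<open>On its support \<open>mode\<close> is monotone in time, in the direction given by the sign of \<open>rate\<close>; the
  jump at \<open>t\<close> is the only other source of variation.\<close>

lemma mode_variation:
  assumes "0 \<le> t" "t \<le> T"
  obtains G where "\<And>s s'. 0 \<le> s \<Longrightarrow> s \<le> s' \<Longrightarrow> s' \<le> T \<Longrightarrow> \<bar>mode \<mu> t k s' - mode \<mu> t k s\<bar> \<le> G s' - G s"
    and "0 \<le> G T - G 0" "G T - G 0 \<le> 2 * exp (\<mu>\<^sup>2 / 2 * T)"
proof -
  \<comment> \<open>\<open>F\<close> follows the exponential up to \<open>t\<close> and is frozen at
    its value 1 afterwards, and \<open>H\<close> is the unit jump at \<open>t\<close>. With the sign
    \<open>\<sigma>\<close>, both parts of \<open>\<sigma> * F + H\<close> increase; each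
    contributes at most one \<open>exp (\<mu>^2 / 2 * T)\<close> to the total.\<close>
  define F where "F s = exp (- (rate \<mu> k * (t - min s t)))" for s
  define H :: "real \<Rightarrow> real" where "H s = (if s < t then 0 else 1)" for s
  define \<sigma> :: real where "\<sigma> = (if rate \<mu> k \<ge> 0 then 1 else - 1)"
  have mode: "mode \<mu> t k s = F s - H s" for s by (simp add: mode_def F_def H_def)
  have F: "\<bar>F s' - F s\<bar> = \<sigma> * (F s' - F s)" if "s \<le> s'" for s s'
  proof (cases "rate \<mu> k \<ge> 0")
    case True
    then have "rate \<mu> k * (t - min s' t) \<le> rate \<mu> k * (t - min s t)"
      using that by (intro mult_left_mono) auto
    then show ?thesis using True by (simp add: F_def \<sigma>_def)
  next
    case False
    then have "rate \<mu> k * (t - min s t) \<le> rate \<mu> k * (t - min s' t)"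
      using that by (intro mult_left_mono_neg) auto
    then show ?thesis using False by (simp add: F_def \<sigma>_def)
  qed
  have H: "\<bar>H s' - H s\<bar> = H s' - H s" if "s \<le> s'" for s s' using that by (simp add: H_def)
  have F0: "0 \<le> F s" "F s \<le> exp (\<mu>\<^sup>2 / 2 * T)" if "0 \<le> s" for s
    using that assms exp_rate_bound[of "t - min s t" T \<mu> k] by (auto simp: F_def)
  have T: "0 \<le> T" using assms by simp
  show thesis
  proof (rule that[of "\<lambda>s. \<sigma> * F s + H s"])
    fix s s' :: real assume "s \<le> s'"
    from F[OF this] H[OF this] show "\<bar>mode \<mu> t k s' - mode \<mu> t k s\<bar> \<le> \<sigma> * F s' + H s' - (\<sigma> * F s + H s)"
      unfolding mode by (simp add: algebra_simps)
  next
    have "\<bar>F T - F 0\<bar> \<le> exp (\<mu>\<^sup>2 / 2 * T)" using F0[OF T] F0[of 0] by simp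
    moreover have "1 \<le> exp (\<mu>\<^sup>2 / 2 * T)" using T by simp
    moreover have "0 \<le> H T - H 0" "H T - H 0 \<le> 1" using T assms by (auto simp: H_def)
    ultimately show "0 \<le> \<sigma> * F T + H T - (\<sigma> * F 0 + H 0)"
      "\<sigma> * F T + H T - (\<sigma> * F 0 + H 0) \<le> 2 * exp (\<mu>\<^sup>2 / 2 * T)"
      using F[OF T] unfolding right_diff_distrib by linarith+
  qed
qed

text \<open>The weight \<open>lam k\<close> stems from the spatial derivative of the noise.
  Averaging does not increase energy, hence the first bound. In the second, 4 is the square of the
  factor 2 in the variation bound and \<open>pi^2\<close> comes from \<open>(lam k)^2\<close>. The
  third serves the modes beyond \<open>M\<close>, from which nothing is subtracted.\<close>

lemma mode_projection_error:
  fixes \<mu> T t :: real and N k :: nat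
  assumes T: "T > 0" "N \<ge> 1" and t: "0 \<le> t" "t \<le> T" and k: "k \<ge> 1"
  defines "err \<equiv> \<integral>\<^sup>+s\<in>{0..T}. ennreal ((lam k * (mode \<mu> t k s -
      (\<Sum>n\<in>{1..N}. indicator (time_slab T N n) s * slab_avg T N (mode \<mu> t k) n)))\<^sup>2) \<partial>lborel"
  shows "err \<le> ennreal (exp (\<mu>\<^sup>2 * T) / (real k)\<^sup>2)"
    and "err \<le> ennreal (4 * pi\<^sup>2 * exp (\<mu>\<^sup>2 * T) * (real k)\<^sup>2 * (T / real N))"
    and "(\<integral>\<^sup>+s\<in>{0..T}. ennreal ((lam k * mode \<mu> t k s)\<^sup>2) \<partial>lborel) \<le> ennreal (exp (\<mu>\<^sup>2 * T) / (real k)\<^sup>2)"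
proof -
  let ?e = "\<integral>\<^sup>+s\<in>{0..T}. ennreal ((mode \<mu> t k s -
      (\<Sum>n\<in>{1..N}. indicator (time_slab T N n) s * slab_avg T N (mode \<mu> t k) n))\<^sup>2) \<partial>lborel"
  let ?m = "\<integral>\<^sup>+s\<in>{0..T}. ennreal ((mode \<mu> t k s)\<^sup>2) \<partial>lborel"
  have pull: "(\<integral>\<^sup>+s\<in>{0..T}. ennreal ((lam k * f s)\<^sup>2) \<partial>lborel) =
      ennreal ((lam k)\<^sup>2) * (\<integral>\<^sup>+s\<in>{0..T}. ennreal ((f s)\<^sup>2) \<partial>lborel)"
    if [measurable]: "f \<in> borel_measurable borel" for f :: "real \<Rightarrow> real"
    by (subst nn_integral_cmult[symmetric])
       (auto intro!: nn_integral_cong simp: power_mult_distrib ennreal_mult mult.assoc)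
  have err: "err = ennreal ((lam k)\<^sup>2) * ?e"
    unfolding err_def by (rule pull) measurable
  have bound: "\<bar>mode \<mu> t k s\<bar> \<le> exp (\<mu>\<^sup>2 / 2 * T)" if "s \<in> {0..T}" for s
    using that t by (intro abs_mode_le) auto
  have l: "lam k \<ge> real k" "lam k > 0" using lam_ge[of k] k by auto
  have "ennreal ((lam k)\<^sup>2) * ?m \<le> ennreal ((lam k)\<^sup>2) * ennreal (exp (\<mu>\<^sup>2 * T) / (lam k) ^ 4)"
    by (intro mult_left_mono mode_energy_le t k) simp
  also have "\<dots> = ennreal (exp (\<mu>\<^sup>2 * T) / (lam k)\<^sup>2)"
    using l by (simp add: ennreal_mult[symmetric] power2_eq_square power4_eq_xxxx)
  also have "\<dots> \<le> ennreal (exp (\<mu>\<^sup>2 * T) / (real k)\<^sup>2)"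
    using l k by (intro ennreal_leI divide_left_mono power_mono) auto
  finally have m: "ennreal ((lam k)\<^sup>2) * ?m \<le> ennreal (exp (\<mu>\<^sup>2 * T) / (real k)\<^sup>2)" .
  then show "(\<integral>\<^sup>+s\<in>{0..T}. ennreal ((lam k * mode \<mu> t k s)\<^sup>2) \<partial>lborel) \<le>
      ennreal (exp (\<mu>\<^sup>2 * T) / (real k)\<^sup>2)"
    by (subst pull) auto
  have "?e \<le> ?m" by (rule slab_projection_error(1)[OF T mode_measurable bound])
  then have "err \<le> ennreal ((lam k)\<^sup>2) * ?m" unfolding err by (intro mult_left_mono) auto
  then show "err \<le> ennreal (exp (\<mu>\<^sup>2 * T) / (real k)\<^sup>2)" using m by (rule order.trans)
  obtain G where G: "\<And>s s'. 0 \<le> s \<Longrightarrow> s \<le> s' \<Longrightarrow> s' \<le> T \<Longrightarrow> \<bar>mode \<mu> t k s' - mode \<mu> t k s\<bar> \<le> G s' - G s"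
    "0 \<le> G T - G 0" "G T - G 0 \<le> 2 * exp (\<mu>\<^sup>2 / 2 * T)"
    using mode_variation[OF t] by blast
  have "(G T - G 0)\<^sup>2 \<le> (2 * exp (\<mu>\<^sup>2 / 2 * T))\<^sup>2" by (intro power_mono G)
  also have "\<dots> = 4 * exp (\<mu>\<^sup>2 * T)" by (simp add: power_mult_distrib power2_eq_square[of "exp _"] exp_add[symmetric])
  finally have sq: "(G T - G 0)\<^sup>2 \<le> 4 * exp (\<mu>\<^sup>2 * T)" .
  have "?e \<le> ennreal (T / real N * (G T - G 0)\<^sup>2)"
    by (rule slab_projection_error(2)[OF T mode_measurable bound G(1)])
  also have "\<dots> \<le> ennreal (T / real N * (4 * exp (\<mu>\<^sup>2 * T)))"
    using T sq by (intro ennreal_leI mult_left_mono) auto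
  finally have "err \<le> ennreal ((lam k)\<^sup>2) * ennreal (T / real N * (4 * exp (\<mu>\<^sup>2 * T)))"
    unfolding err by (intro mult_left_mono) auto
  also have "\<dots> = ennreal (4 * pi\<^sup>2 * exp (\<mu>\<^sup>2 * T) * (real k)\<^sup>2 * (T / real N))"
    using T by (simp add: ennreal_mult[symmetric] lam_def power_mult_distrib mult_ac)
  finally show "err \<le> ennreal (4 * pi\<^sup>2 * exp (\<mu>\<^sup>2 * T) * (real k)\<^sup>2 * (T / real N))" .
qed

text \<open>The load is a finite sum, so the integral in \<open>y\<close> extracts one mode of the
  kernel for each \<open>i\<close>, and the integral in \<open>s\<close> with the factor of the load
  forms its slab average. In this shape \<open>wiener_sub_sum\<close> can handle the canvas
  solution.\<close>

lemma canvas_solution_eq: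
  assumes T: "T > 0" "N \<ge> 1" and t: "t \<le> T"
  shows "canvas_solution T \<mu> N M R t x \<omega> =
    (\<Sum>(i, n)\<in>{1..M} \<times> {1..N}. - (lam i * eps i x) * slab_avg T N (mode \<mu> t i) n * R i n \<omega>)"
proof -
  define d where "d = T / real N"
  let ?J = "{1..M} \<times> {1..N}"
  let ?c = "\<lambda>(i, n). - (lam i * eps i x) * (1 / d) * R i n \<omega>"
  have load: "canvas_load T N M R s y \<omega> =
      (\<Sum>(i, n)\<in>?J. indicator (time_slab T N n) s * (1 / d) * R i n \<omega> * phi i y)" for s y
    unfolding canvas_load_def
    by (subst sum.swap[THEN trans[OF _ sum.cartesian_product[of _ "{1..N}" "{1..M}"]], symmetric])
       (simp_all add: d_def sum_distrib_left mult_ac)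
  have inner: "(LINT y:domD|lborel. Psi \<mu> (t - s) x y * canvas_load T N M R s y \<omega>) =
      (\<Sum>j\<in>?J. ?c j * (indicator (time_slab T N (snd j)) s * mode \<mu> t (fst j) s))" if "s < t" for s
  proof -
    have r: "t - s > 0" using that by simp
    have "(LINT y:domD|lborel. Psi \<mu> (t - s) x y * canvas_load T N M R s y \<omega>) =
        (LINT y:domD|lborel. \<Sum>j\<in>?J. (indicator (time_slab T N (snd j)) s * (1 / d) * R (fst j) (snd j) \<omega>) *
          (Psi \<mu> (t - s) x y * phi (fst j) y))"
      unfolding load by (simp add: sum_distrib_left case_prod_unfold mult_ac)
    also have "\<dots> = (\<Sum>j\<in>?J. LINT y:domD|lborel. (indicator (time_slab T N (snd j)) s * (1 / d) * R (fst j) (snd j) \<omega>) *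
          (Psi \<mu> (t - s) x y * phi (fst j) y))"
      by (intro set_integral_finite_sum set_integrable_mult_right Psi_phi_integral(1)[OF r]) auto
    also have "\<dots> = (\<Sum>j\<in>?J. (indicator (time_slab T N (snd j)) s * (1 / d) * R (fst j) (snd j) \<omega>) *
          (- (lam (fst j) * exp (- (rate \<mu> (fst j) * (t - s))) * eps (fst j) x)))"
      by (intro sum.cong refl)
         (subst set_integral_mult_right, auto simp: Psi_phi_integral[OF r])
    finally show ?thesis using that by (simp add: case_prod_unfold mode_def mult_ac)
  qed
  have int: "integrable lborel (\<lambda>s. indicator (time_slab T N n) s * mode \<mu> t i s)" if "n \<in> {1..N}" for i n
  proof (rule Bochner_Integration.integrable_bound)
    show "integrable lborel (\<lambda>s. exp (\<mu>\<^sup>2 / 2 * T) * indicator {0..T} s)" using T by simp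
    show "AE s in lborel. norm (indicator (time_slab T N n) s * mode \<mu> t i s) \<le>
        norm (exp (\<mu>\<^sup>2 / 2 * T) * indicator {0..T} s)"
    proof (rule AE_I2)
      fix s
      show "norm (indicator (time_slab T N n) s * mode \<mu> t i s) \<le>
        norm (exp (\<mu>\<^sup>2 / 2 * T) * indicator {0..T} s)"
        using abs_mode_le[of s t T \<mu> i] time_slab_subset[OF T that] t T
        by (cases "s \<in> time_slab T N n") auto
    qed
  qed measurable
  have "canvas_solution T \<mu> N M R t x \<omega> =
     (LINT s:{0<..<t}|lborel. \<Sum>j\<in>?J. ?c j * (indicator (time_slab T N (snd j)) s * mode \<mu> t (fst j) s))"
    unfolding canvas_solution_def by (intro set_lebesgue_integral_cong) (auto simp: inner)
  \<comment> \<open>The summands already contain the restriction to \<open>{0<..<t}\<close>: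
    \<open>mode\<close> vanishes from \<open>t\<close> on, and no slab meets the times up to
    0.\<close>
  also have "\<dots> = (LINT s|lborel. (\<Sum>j\<in>?J. ?c j * (indicator (time_slab T N (snd j)) s * mode \<mu> t (fst j) s)))"
    unfolding set_lebesgue_integral_def
  proof (intro Bochner_Integration.integral_cong refl)
    fix s
    show "indicator {0<..<t} s *\<^sub>R (\<Sum>j\<in>?J. ?c j * (indicator (time_slab T N (snd j)) s * mode \<mu> t (fst j) s)) =
       (\<Sum>j\<in>?J. ?c j * (indicator (time_slab T N (snd j)) s * mode \<mu> t (fst j) s))"
    proof (cases "s \<in> {0<..<t}")
      case False
      have "indicator (time_slab T N (snd j)) s * mode \<mu> t (fst j) s = 0" if "j \<in> ?J" for j
      proof (cases "0 < s")
        case True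
        then show ?thesis using False by (simp add: mode_def)
      next
        case False
        have "time_slab T N (snd j) \<subseteq> {0<..<T}" using that by (intro time_slab_subset T) auto
        then have "s \<notin> time_slab T N (snd j)" using False by (auto dest: subsetD)
        then show ?thesis by simp
      qed
      then have "(\<Sum>j\<in>?J. ?c j * (indicator (time_slab T N (snd j)) s * mode \<mu> t (fst j) s)) = 0"
        by (intro sum.neutral) simp
      then show ?thesis by simp
    qed simp
  qed
  also have "\<dots> = (\<Sum>j\<in>?J. LINT s|lborel. ?c j * (indicator (time_slab T N (snd j)) s * mode \<mu> t (fst j) s))"
    by (intro Bochner_Integration.integral_sum integrable_mult_right int) auto
  also have "\<dots> = (\<Sum>j\<in>?J. ?c j * (LINT s:time_slab T N (snd j)|lborel. mode \<mu> t (fst j) s))"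
    by (simp add: set_lebesgue_integral_def)
  finally show ?thesis
    by (simp add: slab_avg_def d_def case_prod_unfold mult_ac)
qed

section \<open>The residual kernel and its norm\<close>

lemma nn_integral_lborel_prod:
  fixes f :: "real \<times> real \<Rightarrow> ennreal"
  assumes "f \<in> borel_measurable borel"
  shows "(\<integral>\<^sup>+z. f z \<partial>lborel) = (\<integral>\<^sup>+s. \<integral>\<^sup>+y. f (s, y) \<partial>lborel \<partial>lborel)"
  using assms by (subst lborel_prod[symmetric], subst lborel.nn_integral_fst) (auto simp: lborel_prod)

text \<open>Puts the residual into the form required by \<open>phi_series_norm_le\<close>: modes up
  to \<open>M\<close> lose their slab average, later ones stay whole. Past \<open>t\<close> both the
  kernel and all modes are 0, so one formula covers every \<open>s\<close>.\<close>

lemma residual_series: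
  assumes "y \<in> domD"
  shows "(\<lambda>j. - eps (Suc j) x * (lam (Suc j) * (mode \<mu> t (Suc j) s - (if Suc j \<le> M
        then \<Sum>n\<in>{1..N}. indicator (time_slab T N n) s * slab_avg T N (mode \<mu> t (Suc j)) n else 0)))
      * phi (Suc j) y) sums
    ((if s < t then Psi \<mu> (t - s) x y else 0) - (\<Sum>(i, n)\<in>{1..M} \<times> {1..N}.
       - (lam i * eps i x) * slab_avg T N (mode \<mu> t i) n * (indicator (time_slab T N n) s * phi i y)))"
proof -
  define h where "h i = (\<Sum>n\<in>{1..N}. - (lam i * eps i x) * slab_avg T N (mode \<mu> t i) n *
      (indicator (time_slab T N n) s * phi i y))" for i
  have h: "h i = - eps i x * (lam i * (\<Sum>n\<in>{1..N}. indicator (time_slab T N n) s * slab_avg T N (mode \<mu> t i) n)) * phi i y" for i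
    unfolding h_def sum_distrib_left sum_distrib_right by (intro sum.cong refl) (simp add: mult_ac)
  have 1: "(\<lambda>j. - eps (Suc j) x * (lam (Suc j) * mode \<mu> t (Suc j) s) * phi (Suc j) y) sums
      (if s < t then Psi \<mu> (t - s) x y else 0)"
    using Psi_sums[of "t - s" \<mu> x y] by (simp add: mode_def mult_ac)
  \<comment> \<open>The canvas part is padded with zeros to a series, to be subtracted termwise from
    that of \<open>Psi\<close>.\<close>
  have "(\<lambda>j. if j \<in> {..<M} then h (Suc j) else 0) sums (\<Sum>j\<in>{..<M}. h (Suc j))"
    by (rule sums_If_finite_set) simp
  also have "(\<Sum>j\<in>{..<M}. h (Suc j)) = (\<Sum>i\<in>{1..M}. h i)"
    by (simp add: sum.atLeast1_atMost_eq)
  also have "\<dots> = (\<Sum>(i, n)\<in>{1..M} \<times> {1..N}.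
       - (lam i * eps i x) * slab_avg T N (mode \<mu> t i) n * (indicator (time_slab T N n) s * phi i y))"
    unfolding h_def by (simp add: sum.cartesian_product)
  finally have 2: "(\<lambda>j. if j \<in> {..<M} then h (Suc j) else 0) sums \<dots>" .
  have eq: "- eps (Suc j) x * (lam (Suc j) * (mode \<mu> t (Suc j) s - (if Suc j \<le> M
        then \<Sum>n\<in>{1..N}. indicator (time_slab T N n) s * slab_avg T N (mode \<mu> t (Suc j)) n else 0)))
      * phi (Suc j) y =
      - eps (Suc j) x * (lam (Suc j) * mode \<mu> t (Suc j) s) * phi (Suc j) y -
      (if j \<in> {..<M} then h (Suc j) else 0)" for j
    by (simp add: h algebra_simps Suc_le_eq)
  show ?thesis unfolding eq by (rule sums_diff[OF 1 2])
qed

text \<open>By Tonelli the space integral is taken first, at each fixed time, where the modes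
  decouple; then every mode is integrated in time by itself. Measurability of \<open>r\<close> is a
  hypothesis because \<open>has_wiener_integral\<close> delivers it where the lemma is
  applied.\<close>

lemma kernel_error:
  fixes \<mu> T t x :: real and N M :: nat
  assumes T: "T > 0" "N \<ge> 1" and t: "0 \<le> t" "t \<le> T" and M: "M \<ge> 1"
  defines "r \<equiv> \<lambda>(s, y). (if s < t then Psi \<mu> (t - s) x y else 0) - (\<Sum>(i, n)\<in>{1..M} \<times> {1..N}.
       - (lam i * eps i x) * slab_avg T N (mode \<mu> t i) n * (indicator (time_slab T N n) s * phi i y))"
  assumes r: "r \<in> borel_measurable (restrict_space borel ({0..T} \<times> domD))"
  shows "(\<integral>\<^sup>+z\<in>{0..T} \<times> domD. ennreal ((r z)\<^sup>2) \<partial>lborel) \<le>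
    ennreal (2 * (4 * pi\<^sup>2 + 2) * exp (\<mu>\<^sup>2 * T) * ((T / real N) powr (1 / 4) + 1 / real M))"
proof -
  let ?S = "{0..T} \<times> domD"
  define D where "D j s = lam (Suc j) * (mode \<mu> t (Suc j) s - (if Suc j \<le> M
      then \<Sum>n\<in>{1..N}. indicator (time_slab T N n) s * slab_avg T N (mode \<mu> t (Suc j)) n else 0))" for j s
  have [measurable]: "D j \<in> borel_measurable borel" for j
    unfolding D_def by measurable
  define E where "E = exp (\<mu>\<^sup>2 * T)"
  have S [measurable]: "?S \<in> sets borel"
    unfolding borel_prod[symmetric] by (intro pair_measureI) auto
  have rm: "(\<lambda>z. ennreal ((indicator ?S z *\<^sub>R r z)\<^sup>2)) \<in> borel_measurable borel"
  proof -
    have "?S \<inter> space borel \<in> sets borel" using S by simp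
    with r have m: "(\<lambda>z. indicator ?S z *\<^sub>R r z) \<in> borel_measurable borel"
      by (simp only: borel_measurable_restrict_space_iff)
    show ?thesis by (rule measurable_compose[OF m, where g = "\<lambda>v. ennreal (v\<^sup>2)"]) measurable
  qed
  have "(\<integral>\<^sup>+z\<in>?S. ennreal ((r z)\<^sup>2) \<partial>lborel) = (\<integral>\<^sup>+z. ennreal ((indicator ?S z *\<^sub>R r z)\<^sup>2) \<partial>lborel)"
    by (intro nn_integral_cong) (auto simp: indicator_def)
  also have "\<dots> = (\<integral>\<^sup>+s. \<integral>\<^sup>+y. ennreal ((indicator ?S (s, y) *\<^sub>R r (s, y))\<^sup>2) \<partial>lborel \<partial>lborel)"
    using nn_integral_lborel_prod[OF rm] .
  also have "\<dots> = (\<integral>\<^sup>+s\<in>{0..T}. (\<integral>\<^sup>+y\<in>domD. ennreal ((r (s, y))\<^sup>2) \<partial>lborel) \<partial>lborel)"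
  proof (rule nn_integral_cong)
    fix s
    show "(\<integral>\<^sup>+y. ennreal ((indicator ?S (s, y) *\<^sub>R r (s, y))\<^sup>2) \<partial>lborel) =
        (\<integral>\<^sup>+y\<in>domD. ennreal ((r (s, y))\<^sup>2) \<partial>lborel) * indicator {0..T} s"
      by (cases "s \<in> {0..T}")
         (auto intro!: nn_integral_cong simp: indicator_def)
  qed
  \<comment> \<open>The factor 2 bounds the squared sine in \<open>x\<close> and makes the estimate
    uniform in \<open>x\<close>.\<close>
  also have "\<dots> \<le> (\<integral>\<^sup>+s\<in>{0..T}. (\<Sum>j. 2 * ennreal ((D j s)\<^sup>2)) \<partial>lborel)"
  proof (intro nn_integral_mono mult_right_mono)
    fix s
    have "(\<integral>\<^sup>+y\<in>domD. ennreal ((r (s, y))\<^sup>2) \<partial>lborel) \<le> (\<Sum>j. ennreal ((- eps (Suc j) x * D j s)\<^sup>2))"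
      using residual_series[of _ x \<mu> t s M T N]
      by (intro phi_series_norm_le) (simp add: r_def D_def)
    also have "\<dots> \<le> (\<Sum>j. 2 * ennreal ((D j s)\<^sup>2))"
    proof (intro suminf_le summableI)
      fix j
      have "(- eps (Suc j) x * D j s)\<^sup>2 \<le> 2 * (D j s)\<^sup>2"
        using mult_right_mono[OF eps_square_le[of "Suc j" x] zero_le_power2[of "D j s"]]
        by (simp add: power_mult_distrib)
      then have "ennreal ((- eps (Suc j) x * D j s)\<^sup>2) \<le> ennreal (2 * (D j s)\<^sup>2)"
        by (rule ennreal_leI)
      then show "ennreal ((- eps (Suc j) x * D j s)\<^sup>2) \<le> 2 * ennreal ((D j s)\<^sup>2)"
        by (simp add: ennreal_mult)
    qed
    finally show "(\<integral>\<^sup>+y\<in>domD. ennreal ((r (s, y))\<^sup>2) \<partial>lborel) \<le> (\<Sum>j. 2 * ennreal ((D j s)\<^sup>2))" .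
  qed simp
  also have "\<dots> = (\<integral>\<^sup>+s. (\<Sum>j. 2 * (ennreal ((D j s)\<^sup>2) * indicator {0..T} s)) \<partial>lborel)"
    by (simp only: ennreal_suminf_multc[symmetric] mult.assoc)
  also have "\<dots> = (\<Sum>j. \<integral>\<^sup>+s. 2 * (ennreal ((D j s)\<^sup>2) * indicator {0..T} s) \<partial>lborel)"
    by (rule nn_integral_suminf) measurable
  also have "\<dots> = (\<Sum>j. 2 * (\<integral>\<^sup>+s\<in>{0..T}. ennreal ((D j s)\<^sup>2) \<partial>lborel))"
    by (subst nn_integral_cmult) auto
  also have "\<dots> = 2 * (\<Sum>j. \<integral>\<^sup>+s\<in>{0..T}. ennreal ((D j s)\<^sup>2) \<partial>lborel)"
    by (rule ennreal_suminf_cmult)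
  also have "\<dots> \<le> 2 * ennreal ((4 * pi\<^sup>2 * E + 2 * E) * ((T / real N) powr (1 / 4) + 1 / real M))"
  proof (intro mult_left_mono suminf_min_rate_le)
    fix j
    note err = mode_projection_error[OF T t, of "Suc j" \<mu>]
    show "(\<integral>\<^sup>+s\<in>{0..T}. ennreal ((D j s)\<^sup>2) \<partial>lborel) \<le> ennreal (E / (real (Suc j))\<^sup>2)"
      using err(1,3) unfolding D_def E_def by (cases "Suc j \<le> M") simp_all
    assume "Suc j \<le> M"
    then show "(\<integral>\<^sup>+s\<in>{0..T}. ennreal ((D j s)\<^sup>2) \<partial>lborel) \<le>
        ennreal (4 * pi\<^sup>2 * E * (real (Suc j))\<^sup>2 * (T / real N))"
      using err(2) unfolding D_def E_def by simp
  qed (use T M in \<open>auto simp: E_def\<close>)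
  also have "\<dots> = ennreal (2 * (4 * pi\<^sup>2 + 2) * E * ((T / real N) powr (1 / 4) + 1 / real M))"
  proof -
    have two: "2 * ennreal b = ennreal (2 * b)" if "b \<ge> 0" for b using that by (simp add: ennreal_mult)
    then show ?thesis by (subst two) (auto simp: E_def algebra_simps intro!: add_nonneg_nonneg mult_nonneg_nonneg)
  qed
  finally show ?thesis by (simp add: E_def)
qed

section \<open>From the kernel to the mean-square error\<close>

lemma pointwise_error:
  assumes P: "prob_space P" and T: "T > 0" "N \<ge> 1" and M: "M \<ge> 1"
    and W: "white_noise P ({0..T} \<times> domD) W"
    and u: "mild_solution P T \<mu> W u" and R: "canvas_coeffs P T W N M R"
    and t: "t \<in> {0..T}" and x: "x \<in> {0..1}"
  shows "(\<integral>\<^sup>+\<omega>. ennreal ((u t x \<omega> - canvas_solution T \<mu> N M R t x \<omega>)\<^sup>2) \<partial>P) \<le>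
    ennreal (8 * (4 * pi\<^sup>2 + 2) * exp (\<mu>\<^sup>2 * T) * ((T / real N) powr (1 / 4) + 1 / real M))"
proof -
  let ?S = "{0..T} \<times> domD" and ?J = "{1..M} \<times> {1..N}"
  interpret prob_space P by fact
  interpret finite_white_noise P ?S W
  proof
    show "?S \<in> sets borel" unfolding borel_prod[symmetric] by (intro pair_measureI) auto
    have "emeasure lborel ?S = emeasure lborel {0..T} * emeasure lborel domD"
      unfolding lborel_prod[symmetric] by (intro lborel.emeasure_pair_measure_Times) auto
    then show "emeasure lborel ?S < \<infinity>" using T by (simp add: emeasure_domD)
  qed (fact W)
  define a where "a j = - (lam (fst j) * eps (fst j) x) * slab_avg T N (mode \<mu> t (fst j)) (snd j)" for j
  define g where "g = (\<lambda>(s, y). if s < t then Psi \<mu> (t - s) x y else 0)"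
  define h where "h j = (\<lambda>(s, y). indicator (time_slab T N (snd j)) s * phi (fst j) y)" for j
  define r where "r = (\<lambda>z. g z - (\<Sum>j\<in>?J. a j * h j z))"
  have "has_wiener_integral P ?S W r (\<lambda>\<omega>. u t x \<omega> - (\<Sum>j\<in>?J. a j * R (fst j) (snd j) \<omega>))"
    unfolding r_def
  proof (rule wiener_sub_sum)
    show "has_wiener_integral P ?S W g (u t x)" using u t x unfolding mild_solution_def g_def by auto
    show "has_wiener_integral P ?S W (h j) (R (fst j) (snd j))" if "j \<in> ?J" for j
      using R that unfolding canvas_coeffs_def h_def by auto
  qed simp
  also have "(\<lambda>\<omega>. u t x \<omega> - (\<Sum>j\<in>?J. a j * R (fst j) (snd j) \<omega>)) =
      (\<lambda>\<omega>. u t x \<omega> - canvas_solution T \<mu> N M R t x \<omega>)"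
    using t by (subst canvas_solution_eq[OF T]) (auto simp: a_def case_prod_unfold)
  finally have W: "has_wiener_integral P ?S W r (\<lambda>\<omega>. u t x \<omega> - canvas_solution T \<mu> N M R t x \<omega>)" .
  have r: "r = (\<lambda>(s, y). (if s < t then Psi \<mu> (t - s) x y else 0) - (\<Sum>(i, n)\<in>{1..M} \<times> {1..N}.
       - (lam i * eps i x) * slab_avg T N (mode \<mu> t i) n * (indicator (time_slab T N n) s * phi i y)))"
    by (simp add: r_def g_def h_def a_def case_prod_unfold)
  have "(\<integral>\<^sup>+\<omega>. ennreal ((u t x \<omega> - canvas_solution T \<mu> N M R t x \<omega>)\<^sup>2) \<partial>P) \<le>
      4 * (\<integral>\<^sup>+z\<in>?S. ennreal ((r z)\<^sup>2) \<partial>lborel)"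
    by (rule wiener_second_moment_le[OF W])
  \<comment> \<open>The final 8 is this 4, from the second moment bound, times the 2 in
    \<open>kernel_error\<close>.\<close>
  also have "\<dots> \<le> 4 * ennreal (2 * (4 * pi\<^sup>2 + 2) * exp (\<mu>\<^sup>2 * T) * ((T / real N) powr (1 / 4) + 1 / real M))"
    using W t unfolding r has_wiener_integral_def
    by (intro mult_left_mono kernel_error T M) auto
  also have "\<dots> = ennreal (8 * (4 * pi\<^sup>2 + 2) * exp (\<mu>\<^sup>2 * T) * ((T / real N) powr (1 / 4) + 1 / real M))"
  proof -
    have four: "4 * ennreal b = ennreal (4 * b)" if "b \<ge> 0" for b using that by (simp add: ennreal_mult)
    then show ?thesis by (subst four) (auto simp: mult_ac intro!: add_nonneg_nonneg mult_nonneg_nonneg)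
  qed
  finally show ?thesis .
qed

text \<open>Joint measurability permits exchanging expectation and space integral, and
  \<open>domD\<close> has measure 1, so a bound uniform in \<open>x\<close> passes to the norm with
  the same constant.\<close>

lemma rms_L2_le:
  assumes P: "prob_space P"
    and v: "(\<lambda>(\<omega>, x). v x \<omega>) \<in> borel_measurable (P \<Otimes>\<^sub>M restrict_space borel {0..1})"
    and C: "C \<ge> 0"
    and le: "\<And>x. x \<in> {0..1} \<Longrightarrow> (\<integral>\<^sup>+\<omega>. ennreal ((v x \<omega>)\<^sup>2) \<partial>P) \<le> ennreal (C\<^sup>2)"
  shows "rms_L2 P v \<le> ennreal C"
proof -
  interpret prob_space P by fact
  let ?N = "restrict_space lborel domD"
  interpret N: finite_measure ?N
    by (rule finite_measureI)
       (simp add: emeasure_restrict_space space_restrict_space emeasure_domD)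
  interpret pair_sigma_finite P ?N ..
  have id: "(\<lambda>x. x) \<in> measurable ?N (restrict_space borel {0..1})"
    by (rule measurable_restrict_space3[of "\<lambda>x. x" lborel borel, unfolded measurable_lborel2])
       (auto simp: domD_def)
  have "(\<lambda>(\<omega>, x). v x \<omega>) \<circ> (\<lambda>(\<omega>, x). (\<omega>, x)) \<in> borel_measurable (P \<Otimes>\<^sub>M ?N)"
    by (rule measurable_comp[OF _ v]) (use id in measurable)
  then have [measurable]: "(\<lambda>(\<omega>, x). v x \<omega>) \<in> borel_measurable (P \<Otimes>\<^sub>M ?N)"
    by (simp add: comp_def case_prod_unfold)
  have "(\<integral>\<^sup>+\<omega>. (\<integral>\<^sup>+x\<in>domD. ennreal ((v x \<omega>)\<^sup>2) \<partial>lborel) \<partial>P) =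
      (\<integral>\<^sup>+\<omega>. (\<integral>\<^sup>+x. ennreal ((v x \<omega>)\<^sup>2) \<partial>?N) \<partial>P)"
    by (simp add: nn_integral_restrict_space)
  also have "\<dots> = (\<integral>\<^sup>+x. (\<integral>\<^sup>+\<omega>. ennreal ((v x \<omega>)\<^sup>2) \<partial>P) \<partial>?N)"
    by (rule Fubini'[symmetric]) measurable
  also have "\<dots> \<le> (\<integral>\<^sup>+x. ennreal (C\<^sup>2) \<partial>?N)"
    by (intro nn_integral_mono le) (auto simp: space_restrict_space domD_def)
  also have "\<dots> = ennreal (C\<^sup>2)"
    by (simp add: emeasure_restrict_space emeasure_domD space_restrict_space)
  finally have le: "(\<integral>\<^sup>+\<omega>. (\<integral>\<^sup>+x\<in>domD. ennreal ((v x \<omega>)\<^sup>2) \<partial>lborel) \<partial>P) \<le> ennreal (C\<^sup>2)" .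
  then have "enn2real (\<integral>\<^sup>+\<omega>. (\<integral>\<^sup>+x\<in>domD. ennreal ((v x \<omega>)\<^sup>2) \<partial>lborel) \<partial>P) \<le> C\<^sup>2"
    by (intro enn2real_leI) auto
  then have "sqrt (enn2real (\<integral>\<^sup>+\<omega>. (\<integral>\<^sup>+x\<in>domD. ennreal ((v x \<omega>)\<^sup>2) \<partial>lborel) \<partial>P)) \<le> C"
    using C by (intro real_le_lsqrt) auto
  then show ?thesis using le unfolding rms_L2_def ennreal_sqrt_def
    by (auto intro!: ennreal_leI simp: top_unique)
qed

theorem theorem3p1:
  fixes P :: "'w measure"
    and W :: "(real \<times> real) set \<Rightarrow> 'w \<Rightarrow> real"
    and u :: "real \<Rightarrow> real \<Rightarrow> 'w \<Rightarrow> real"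
    and T \<mu> :: real
    and \<kappa> :: nat
  assumes "prob_space P" and "complete_measure P"
    and "T > 0"
    and "white_noise P ({0..T} \<times> domD) W"
    and "mild_solution P T \<mu> W u"
    and "\<kappa> \<ge> 1" and "(real \<kappa>)\<^sup>2 * pi\<^sup>2 > \<mu>"
  shows "\<exists>c>0. \<forall>N\<ge>1. \<forall>M\<ge>\<kappa>. \<forall>R. canvas_coeffs P T W N M R \<longrightarrow>
           (SUP t\<in>{0..T}. rms_L2 P (\<lambda>x \<omega>. u t x \<omega> - canvas_solution T \<mu> N M R t x \<omega>))
             \<le> ennreal (c * ((T / real N) powr (1 / 8) + real M powr (- 1 / 2)))"
proof -
  \<comment> \<open>The constant of \<open>pointwise_error\<close>. It involves only \<mu> and
    \<open>T\<close>, so its root serves for all \<open>N\<close>, \<open>M\<close> and all versions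
    \<open>R\<close>.\<close>
  define B where "B = 8 * (4 * pi\<^sup>2 + 2) * exp (\<mu>\<^sup>2 * T)"
  have B: "B > 0" unfolding B_def by (intro mult_pos_pos add_nonneg_pos) auto
  have "(SUP t\<in>{0..T}. rms_L2 P (\<lambda>x \<omega>. u t x \<omega> - canvas_solution T \<mu> N M R t x \<omega>))
      \<le> ennreal (sqrt B * ((T / real N) powr (1 / 8) + real M powr (- 1 / 2)))"
    if N: "N \<ge> 1" and "M \<ge> \<kappa>" and R: "canvas_coeffs P T W N M R" for N M R
  proof (rule SUP_least, rule rms_L2_le)
    have M: "M \<ge> 1" using that assms by simp
    define a b where "a = (T / real N) powr (1 / 8)" and "b = real M powr (- 1 / 2)"
    have ab: "a \<ge> 0" "b \<ge> 0" by (simp_all add: a_def b_def)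
    have sq: "a\<^sup>2 = (T / real N) powr (1 / 4)" "b\<^sup>2 = 1 / real M"
    proof -
      have "T / real N > 0" using assms N by simp
      then show "a\<^sup>2 = (T / real N) powr (1 / 4)" unfolding a_def using N by (subst powr_power) auto
      have "b\<^sup>2 = real M powr (- 1)" unfolding b_def using M by (subst powr_power) auto
      then show "b\<^sup>2 = 1 / real M" using M by (simp add: powr_minus_divide)
    qed
    show "0 \<le> sqrt B * (a + b)" using B ab by simp
    fix t assume t: "t \<in> {0..T}"
    show "prob_space P" by fact
    let ?Q = "P \<Otimes>\<^sub>M restrict_space borel {0..1 :: real}"
    have R_m: "(\<lambda>z. R i n (fst z)) \<in> borel_measurable ?Q" if "i \<in> {1..M}" "n \<in> {1..N}" for i n
      using R that by (intro measurable_compose[OF measurable_fst])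
        (auto simp: canvas_coeffs_def has_wiener_integral_def)
    have eps_m: "(\<lambda>z. eps k (snd z)) \<in> borel_measurable ?Q" for k
      by (intro measurable_compose[OF measurable_snd] measurable_restrict_space1 eps_measurable)
    have "(\<lambda>(\<omega>, x). canvas_solution T \<mu> N M R t x \<omega>) =
      (\<lambda>z. \<Sum>j\<in>{1..M} \<times> {1..N}. - (lam (fst j) * eps (fst j) (snd z)) *
        slab_avg T N (mode \<mu> t (fst j)) (snd j) * R (fst j) (snd j) (fst z))"
      using t assms N by (subst canvas_solution_eq) (auto simp: case_prod_unfold)
    also have "\<dots> \<in> borel_measurable ?Q"
      by (intro borel_measurable_sum borel_measurable_times borel_measurable_uminus
        borel_measurable_const eps_m R_m) auto
    finally show "(\<lambda>(\<omega>, x). u t x \<omega> - canvas_solution T \<mu> N M R t x \<omega>) \<in> borel_measurable ?Q"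
      using assms(5) t unfolding mild_solution_def case_prod_unfold
      by (intro borel_measurable_diff) auto
    fix x :: real assume "x \<in> {0..1}"
    then have "(\<integral>\<^sup>+\<omega>. ennreal ((u t x \<omega> - canvas_solution T \<mu> N M R t x \<omega>)\<^sup>2) \<partial>P) \<le> ennreal (B * (a\<^sup>2 + b\<^sup>2))"
      unfolding B_def sq by (rule pointwise_error[OF assms(1,3) N M assms(4,5) R t])
    \<comment> \<open>Since \<open>a\<close> and \<open>b\<close> are nonnegative,
      \<open>a^2 + b^2\<close> is at most \<open>(a + b)^2\<close>; the root thus splits into the
      two rates of the claim.\<close>
    also have "\<dots> \<le> ennreal ((sqrt B * (a + b))\<^sup>2)"
      using B ab by (intro ennreal_leI) (simp add: power_mult_distrib power2_sum)
    finally show "(\<integral>\<^sup>+\<omega>. ennreal ((u t x \<omega> - canvas_solution T \<mu> N M R t x \<omega>)\<^sup>2) \<partial>P)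
      \<le> ennreal ((sqrt B * (a + b))\<^sup>2)" .
  qed
  then show ?thesis using B by (intro exI[of _ "sqrt B"]) auto
qed

end
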